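(* Assume (A1), (A2), (A3) of the context. For any preference vector $w\in\Delta^{++}_{m-1}$, suppose $\gamma\in\left(0,\frac{1}{2\rho_y}\right)$, $c_t=c_0>0$ for all $t$, and $0<\underline{\alpha}_\theta\le\alpha_{\theta,t}<\frac{2\gamma}{\gamma(L_g-\rho_y)+2}$ for all $t$. Then there exist $\overline{\alpha}_x,\overline{\alpha}_y$ such that, when $\alpha_{x,t}\in[\underline{\alpha}_x,\overline{\alpha}_x]$ and $\alpha_{y,t}\in[\underline{\alpha}_y,\overline{\alpha}_y]$ for all $t$ with $\underline{\alpha}_x,\underline{\alpha}_y>0$, for the iterates $(x_t,y_t,\theta_t)$ of the MOMEHA algorithm there exists for each $t$ a multiplier $p_t\ge 0$ such that $$\varepsilon_T:=g(x_T,y_T)-\upsilon_\gamma(x_T,y_T)=\mathcal{O}(1),\qquad \min_{0\le t\le T}H_{p_t}(x_{t+1},y_{t+1};\varepsilon_{t+1})=\mathcal{O}\left(T^{-\frac12}\right),$$ i.e. $\mathcal{O}(1)$-$\mathcal{O}(T^{-1/2})$-Pareto stationarity in the best case. Furthermore, if $\mathcal{P}_{c_t}(x_t,y_t)$ is bounded above (uniformly in $t$) and $c_t=c_0(1+t)^{\frac14}$, then (the other conditions being unchanged) $$\varepsilon_T=\mathcal{O}\left(T^{-\frac14}\right),\qquad \min_{0\le t\le T}H_{p_t}(x_{t+1},y_{t+1};\varepsilon_{t+1})=\mathcal{O}\left(T^{-\frac14}\right),$$ i.e. $\mathcal{O}(T^{-1/4})$-$\mathcal{O}(T^{-1/4})$-Pareto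 stationarity in the best case.
   Context: **Problem data.** $f_1,\dots,f_m,g:\mathbb{R}^{d_x}\times\mathbb{R}^{d_y}\to\mathbb{R}$. $\Delta_{m-1}=\{\lambda\in\mathbb{R}^m:\lambda_i\ge0,\sum_i\lambda_i=1\}$ and $\Delta^{++}_{m-1}$ is its subset of vectors with all entries strictly positive. For a preference $w$, a smoothing parameter $\mu>0$ and ideal values $z_i$ with $z_i<f_i$ everywhere, the smooth Tchebycheff scalarization is $$F^{(\mathrm{STCH})}_w(x,y)=\frac1\mu\log\Big(\sum_{i=1}^m\exp\big(\mu w_i(f_i(x,y)-z_i)\big)\Big).$$ For $\gamma>0$, $\upsilon_\gamma(x,y)=\min_{\theta\in\mathbb{R}^{d_y}}\{g(x,\theta)+\frac1{2\gamma}\|\theta-y\|^2\}$, and $\theta^*_\gamma(x,y)$ is the minimizer. The penalized objective is $\mathcal{P}_{c}(x,y)=F^{(\mathrm{STCH})}_w(x,y)-\underline F+c\,(g(x,y)-\upsilon_\gamma(x,y))$, with $\underline F$ from (A1). **Assumptions.** (A1) Each $f_i$ is proper and bounded below; consequently $F^{(\mathrm{STCH})}_w$ is bounded below by a constant $\underline F>-\infty$. (A2) Each $f_i$ and $g$ are continuously differentiable with $L_f$- and $L_g$-Lipschitz gradients on $\mathbb{R}^{d_x}\times\mathbb{R}^{d_y}$, respectively; $F^{(\mathrm{STCH})}_w$ is differentiable with $L_F$-Lipschitz gradient (the paper lists this as part of the assumption). By smoothness $g$ is $(\rho_x,\rho_y)$-weakly convex, i.e. $g(x,y)+\frac{\rho_x}{2}\|x\|^2+\frac{\rho_y}{2}\|y\|^2$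 is convex, with constants $\rho_x,\rho_y>0$. (A3) With $V_0:=\frac1{c_0}\mathcal{P}_{c_0}(x_0,y_0)+\left(L_g^2+\frac1{\gamma^2}\right)\|\theta_0-\theta^*_\gamma(x_0,y_0)\|^2$: for every $(x,y)$ with $0<g(x,y)-\upsilon_\gamma(x,y)\le V_0$ one has $\nabla g(x,y)-\nabla\upsilon_\gamma(x,y)\ne0$. **MOMEHA algorithm.** Given $x_0,y_0$ and $\theta_0=y_0$, step sizes $\alpha_{\theta,t},\alpha_{x,t},\alpha_{y,t}$ and penalty factors $c_t$, for $t=0,1,\dots$: $\theta_{t+1}=\theta_t-\alpha_{\theta,t}d_{\theta,t}$ with $d_{\theta,t}=\nabla_yg(x_t,\theta_t)+\frac1\gamma(\theta_t-y_t)$; $x_{t+1}=x_t-\alpha_{x,t}d_{x,t}$ with $d_{x,t}=\frac1{c_t}\nabla_xF^{(\mathrm{STCH})}_w(x_t,y_t)+\nabla_xg(x_t,y_t)-\nabla_xg(x_t,\theta_{t+1})$; $y_{t+1}=y_t-\alpha_{y,t}d_{y,t}$ with $d_{y,t}=\frac1{c_t}\nabla_yF^{(\mathrm{STCH})}_w(x_{t+1},y_t)+\nabla_yg(x_{t+1},y_t)+\frac1\gamma(\theta_{t+1}-y_t)$. **Stationarity measure.** For $\varepsilon_c$ and $(x,y)$ in the relaxed feasible set $\{g-\upsilon_\gamma\le\varepsilon_c\}$, and $p\ge0$, $$H_p(x,y;\varepsilon_c)=\min_{\lambda\in\Delta_{m-1}}\Big\|\sum_{i=1}^m\lambda_i\nabla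 f_i(x,y)+p\,(\nabla g(x,y)-\nabla\upsilon_\gamma(x,y))\Big\|,$$ so $H_p(x,y;\varepsilon_c)\le\varepsilon_s$ means that some $\lambda\in\Delta_{m-1}$ makes the norm at most $\varepsilon_s$. The point $(x,y)$ is called $\varepsilon_c$-$\varepsilon_s$-Pareto stationary if $g(x,y)-\upsilon_\gamma(x,y)\le\varepsilon_c$ and $H_p(x,y;\varepsilon_c)\le\varepsilon_s$ for some $p\ge0$. Here $\varepsilon_t=g(x_t,y_t)-\upsilon_\gamma(x_t,y_t)$. The $\mathcal{O}$-notation is for $T\to\infty$. *)

theory Defs
  imports "HOL-Analysis.Analysis" "HOL-Library.Landau_Symbols"
begin

definition grad :: "('a::euclidean_space \<Rightarrow> real) \<Rightarrow> 'a \<Rightarrow> 'a" where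
  "grad f p = (THE D. GDERIV f p :> D)"

lemma grad_eqI:
  assumes "GDERIV f p :> D"
  shows "grad f p = D"
  unfolding grad_def
proof (rule the_equality)
  fix E assume "GDERIV f p :> E"
  then have "(\<lambda>h. h \<bullet> E) = (\<lambda>h. h \<bullet> D)"
    using assms has_derivative_unique unfolding gderiv_def by blast
  then show "E = D" by (metis vector_eq_ldot)
qed (rule assms)

lemma GDERIV_grad:
  fixes f :: "'a::euclidean_space \<Rightarrow> real"
  assumes "f differentiable (at p)"
  shows "GDERIV f p :> grad f p"
proof -
  obtain f' where f': "(f has_derivative f') (at p)"
    using assms unfolding differentiable_def by blast
  have "f' = (\<lambda>h. h \<bullet> adjoint f' 1)"
    using adjoint_works[OF has_derivative_linear[OF f'], of _ "1::real"] by auto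
  with f' have "GDERIV f p :> adjoint f' 1" unfolding gderiv_def by metis
  then show ?thesis using grad_eqI by metis
qed

definition grad_x :: "('a::euclidean_space \<times> 'b::euclidean_space \<Rightarrow> real) \<Rightarrow> 'a \<Rightarrow> 'b \<Rightarrow> 'a" where
  "grad_x h x y = grad (\<lambda>x'. h (x', y)) x"

definition grad_y :: "('a::euclidean_space \<times> 'b::euclidean_space \<Rightarrow> real) \<Rightarrow> 'a \<Rightarrow> 'b \<Rightarrow> 'b" where
  "grad_y h x y = grad (\<lambda>y'. h (x, y')) y"

(* Continuity of the gradient is implied by its Lipschitz continuity. *)
definition lipschitz_smooth :: "real \<Rightarrow> ('a::euclidean_space \<Rightarrow> real) \<Rightarrow> bool" where
  "lipschitz_smooth L h \<longleftrightarrow> (\<forall>p. h differentiable (at p)) \<and> L-lipschitz_on UNIV (grad h)"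

definition weakly_convex ::
    "real \<Rightarrow> real \<Rightarrow> ('a::euclidean_space \<times> 'b::euclidean_space \<Rightarrow> real) \<Rightarrow> bool" where
  "weakly_convex \<rho>x \<rho>y h \<longleftrightarrow>
     convex_on UNIV (\<lambda>(x, y). h (x, y) + \<rho>x / 2 * (norm x)\<^sup>2 + \<rho>y / 2 * (norm y)\<^sup>2)"

definition prob_simplex :: "(real ^ 'm) set" where
  "prob_simplex = {l. (\<forall>i. 0 \<le> l $ i) \<and> (\<Sum>i\<in>UNIV. l $ i) = 1}"

definition pos_simplex :: "(real ^ 'm) set" where
  "pos_simplex = {l \<in> prob_simplex. \<forall>i. 0 < l $ i}"

definition stch :: "real ^ 'm \<Rightarrow> real ^ 'm \<Rightarrow> real \<Rightarrow> ('m \<Rightarrow> 'a \<Rightarrow> real) \<Rightarrow> 'a \<Rightarrow> real" where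
  "stch w z \<mu> f p = 1 / \<mu> * ln (\<Sum>i\<in>UNIV. exp (\<mu> * w $ i * (f i p - z $ i)))"

definition prox_objective ::
    "('a::euclidean_space \<times> 'b::euclidean_space \<Rightarrow> real) \<Rightarrow> real \<Rightarrow> 'a \<times> 'b \<Rightarrow> 'b \<Rightarrow> real" where
  "prox_objective g \<gamma> p \<theta> = g (fst p, \<theta>) + 1 / (2 * \<gamma>) * (norm (\<theta> - snd p))\<^sup>2"

(* For weakly convex g and small \<gamma> the infimum is attained, at the unique minimizer prox_argmin. *)
definition moreau_value ::
    "('a::euclidean_space \<times> 'b::euclidean_space \<Rightarrow> real) \<Rightarrow> real \<Rightarrow> 'a \<times> 'b \<Rightarrow> real" where
  "moreau_value g \<gamma> p = (INF \<theta>. prox_objective g \<gamma> p \<theta>)"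

definition prox_argmin ::
    "('a::euclidean_space \<times> 'b::euclidean_space \<Rightarrow> real) \<Rightarrow> real \<Rightarrow> 'a \<times> 'b \<Rightarrow> 'b" where
  "prox_argmin g \<gamma> p = (ARG_MIN (prox_objective g \<gamma> p) \<theta>. True)"

definition gap ::
    "('a::euclidean_space \<times> 'b::euclidean_space \<Rightarrow> real) \<Rightarrow> real \<Rightarrow> 'a \<times> 'b \<Rightarrow> real" where
  "gap g \<gamma> p = g p - moreau_value g \<gamma> p"

definition penalized ::
    "('a::euclidean_space \<times> 'b::euclidean_space \<Rightarrow> real) \<Rightarrow> real
      \<Rightarrow> ('a \<times> 'b \<Rightarrow> real) \<Rightarrow> real \<Rightarrow> real \<Rightarrow> 'a \<times> 'b \<Rightarrow> real" where
  "penalized F Flow g \<gamma> c p = F p - Flow + c * gap g \<gamma> p"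

definition momeha ::
    "('a::euclidean_space \<times> 'b::euclidean_space \<Rightarrow> real) \<Rightarrow> ('a \<times> 'b \<Rightarrow> real) \<Rightarrow> real
      \<Rightarrow> 'a \<Rightarrow> 'b \<Rightarrow> (nat \<Rightarrow> real) \<Rightarrow> (nat \<Rightarrow> real) \<Rightarrow> (nat \<Rightarrow> real) \<Rightarrow> (nat \<Rightarrow> real)
      \<Rightarrow> (nat \<Rightarrow> 'a) \<Rightarrow> (nat \<Rightarrow> 'b) \<Rightarrow> (nat \<Rightarrow> 'b) \<Rightarrow> bool" where
  "momeha F g \<gamma> x0 y0 a\<theta> ax ay c x y \<theta> \<longleftrightarrow>
     x 0 = x0 \<and> y 0 = y0 \<and> \<theta> 0 = y0 \<and>
     (\<forall>t. \<theta> (Suc t) = \<theta> t - a\<theta> t *\<^sub>R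
            (grad_y g (x t) (\<theta> t) + (1 / \<gamma>) *\<^sub>R (\<theta> t - y t))) \<and>
     (\<forall>t. x (Suc t) = x t - ax t *\<^sub>R
            ((1 / c t) *\<^sub>R grad_x F (x t) (y t) + grad_x g (x t) (y t)
              - grad_x g (x t) (\<theta> (Suc t)))) \<and>
     (\<forall>t. y (Suc t) = y t - ay t *\<^sub>R
            ((1 / c t) *\<^sub>R grad_y F (x (Suc t)) (y t) + grad_y g (x (Suc t)) (y t)
              + (1 / \<gamma>) *\<^sub>R (\<theta> (Suc t) - y t)))"

(* The minimum over the compact simplex.  The tolerance of the relaxed feasible set
   restricts the points at which the measure is considered, but not its value. *)
definition stationarity_measure ::
    "('m::finite \<Rightarrow> 'a::euclidean_space \<times> 'b::euclidean_space \<Rightarrow> real)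
      \<Rightarrow> ('a \<times> 'b \<Rightarrow> real) \<Rightarrow> real \<Rightarrow> real \<Rightarrow> 'a \<times> 'b \<Rightarrow> real" where
  "stationarity_measure f g \<gamma> p u =
     (INF l \<in> prob_simplex. norm ((\<Sum>i\<in>UNIV. l $ i *\<^sub>R grad (f i) u)
        + p *\<^sub>R (grad g u - grad (moreau_value g \<gamma>) u)))"

definition pareto_stationary ::
    "('m::finite \<Rightarrow> 'a::euclidean_space \<times> 'b::euclidean_space \<Rightarrow> real)
      \<Rightarrow> ('a \<times> 'b \<Rightarrow> real) \<Rightarrow> real \<Rightarrow> real \<Rightarrow> real \<Rightarrow> 'a \<times> 'b \<Rightarrow> bool" where
  "pareto_stationary f g \<gamma> \<epsilon>c \<epsilon>s u \<longleftrightarrow>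
     gap g \<gamma> u \<le> \<epsilon>c \<and> (\<exists>p\<ge>0. stationarity_measure f g \<gamma> p u \<le> \<epsilon>s)"

end

theory Submission
  imports Defs
begin

text \<open>Put \<open>V\<^sub>t = P\<^bsub>c\<^esub>(x\<^sub>t, y\<^sub>t) / c\<^sub>t + \<parallel>\<theta>\<^sub>t - \<theta>*(x\<^sub>t, y\<^sub>t)\<parallel>\<^sup>2\<close>.
  The proximal objective is strongly convex and smooth in \<open>\<theta>\<close>, so a gradient step contracts the
  distance to \<open>\<theta>*\<close>, and \<open>\<theta>*\<close> is Lipschitz; hence the Moreau value has a Lipschitz gradient and the
  \<open>x\<close>- and \<open>y\<close>-steps are gradient steps on \<open>P\<^bsub>c\<^esub> / c\<close> with an error controlled by the distance to
  \<open>\<theta>*\<close>. For small step sizes \<open>V\<close> decreases by a multiple of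
  \<open>\<parallel>d\<^sub>x\<parallel>\<^sup>2 + \<parallel>d\<^sub>y\<parallel>\<^sup>2 + \<parallel>\<theta>\<^sub>t - \<theta>*\<parallel>\<^sup>2\<close>, which dominates the squared gradient of \<open>P\<^bsub>c\<^esub> / c\<close> at the
  next iterate, so these squares are summable. The gradient of the scalarization is a nonnegative
  combination of the \<open>\<nabla>f\<^sub>i\<close> whose total weight is bounded below, and normalizing it gives the
  stationarity residual. The best iterate is taken among the last half of the first \<open>T\<close>, so that the
  decay of the gap is available at the same index.\<close>

subsection \<open>Convexity and smoothness\<close>

lemma GDERIV_along_line:
  fixes h :: "'a::real_inner \<Rightarrow> real"
  assumes "GDERIV h (p + s *\<^sub>R d) :> D"
  shows "((\<lambda>s. h (p + s *\<^sub>R d)) has_real_derivative d \<bullet> D) (at s)"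
proof -
  have "((\<lambda>s. p + s *\<^sub>R d) has_derivative (\<lambda>s. s *\<^sub>R d)) (at s)"
    by (auto intro!: derivative_eq_intros)
  from has_derivative_compose[OF this, of h "\<lambda>k. k \<bullet> D"] assms
  show ?thesis
    by (simp add: gderiv_def has_field_derivative_def mult.commute[of _ "d \<bullet> D"])
qed

text \<open>The descent lemma. On the segment from \<open>p\<close> to \<open>q\<close>,
  \<open>h\<close> minus its linear part at \<open>p\<close> and minus the quadratic has nonpositive
  derivative, by Cauchy-Schwarz and the Lipschitz bound.\<close>

lemma gradient_quadratic_upper:
  fixes h :: "'a::real_inner \<Rightarrow> real"
  assumes deriv: "\<And>p. GDERIV h p :> G p"
    and lip: "\<And>p q. norm (G p - G q) \<le> L * norm (p - q)"
  shows "h q \<le> h p + (q - p) \<bullet> G p + L / 2 * (norm (q - p))\<^sup>2"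
proof -
  define d where "d = q - p"
  define \<phi> where "\<phi> s = h (p + s *\<^sub>R d) - s * (d \<bullet> G p) - L / 2 * s\<^sup>2 * (norm d)\<^sup>2" for s
  have \<phi>': "(\<phi> has_real_derivative (d \<bullet> G (p + s *\<^sub>R d) - d \<bullet> G p - L * s * (norm d)\<^sup>2)) (at s)" for s
    unfolding \<phi>_def by (auto intro!: derivative_eq_intros GDERIV_along_line[OF deriv])
  have "\<phi> 1 \<le> \<phi> 0"
  proof (rule DERIV_nonpos_imp_nonincreasing[of 0 1 \<phi>])
    fix s :: real assume s: "0 \<le> s" "s \<le> 1"
    have "d \<bullet> (G (p + s *\<^sub>R d) - G p) \<le> norm d * norm (G (p + s *\<^sub>R d) - G p)"
      by (rule norm_cauchy_schwarz)
    also have "\<dots> \<le> norm d * (L * norm (s *\<^sub>R d))"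
      using lip[of "p + s *\<^sub>R d" p] by (intro mult_left_mono) auto
    also have "\<dots> = L * s * (norm d)\<^sup>2"
      using s by (simp add: power2_eq_square)
    finally show "\<exists>y. (\<phi> has_real_derivative y) (at s) \<and> y \<le> 0"
      using \<phi>' by (intro exI[of _ "d \<bullet> G (p + s *\<^sub>R d) - d \<bullet> G p - L * s * (norm d)\<^sup>2"])
        (auto simp: inner_diff_right)
  qed simp
  then show ?thesis by (simp add: \<phi>_def d_def)
qed

section \<open>Partial gradients as components of the full gradient\<close>

lemma GDERIV_fst_slice:
  assumes "GDERIV h (x, y) :> D"
  shows "GDERIV (\<lambda>x'. h (x', y)) x :> fst D"
proof -
  have "((\<lambda>x'. h (x', y)) has_derivative (\<lambda>k. (k, 0) \<bullet> D)) (at x)"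
    using assms unfolding gderiv_def
    by (intro has_derivative_compose[of "\<lambda>x'. (x', y)" _ x UNIV h])
      (auto intro!: derivative_eq_intros)
  then show ?thesis by (simp add: gderiv_def inner_prod_def)
qed

lemma GDERIV_snd_slice:
  assumes "GDERIV h (x, y) :> D"
  shows "GDERIV (\<lambda>y'. h (x, y')) y :> snd D"
proof -
  have "((\<lambda>y'. h (x, y')) has_derivative (\<lambda>k. (0, k) \<bullet> D)) (at y)"
    using assms unfolding gderiv_def
    by (intro has_derivative_compose[of "\<lambda>y'. (x, y')" _ y UNIV h])
      (auto intro!: derivative_eq_intros)
  then show ?thesis by (simp add: gderiv_def inner_prod_def)
qed

lemma grad_x_eq: "GDERIV h (x, y) :> D \<Longrightarrow> grad_x h x y = fst D"
  unfolding grad_x_def by (intro grad_eqI GDERIV_fst_slice)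

lemma grad_y_eq: "GDERIV h (x, y) :> D \<Longrightarrow> grad_y h x y = snd D"
  unfolding grad_y_def by (intro grad_eqI GDERIV_snd_slice)

text \<open>Restriction to the line through \<open>p\<close> and \<open>q\<close> reduces this to
  the tangent inequality of a convex function of one real variable.\<close>

lemma convex_on_above_gradient:
  fixes h :: "'a::real_inner \<Rightarrow> real"
  assumes "convex_on UNIV h" "GDERIV h p :> D"
  shows "h p + (q - p) \<bullet> D \<le> h q"
proof -
  define \<phi> where "\<phi> s = h (p + s *\<^sub>R (q - p))" for s :: real
  have "convex_on UNIV \<phi>"
  proof (rule convex_onI)
    fix t a b :: real assume t: "0 < t" "t < 1"
    have "p + ((1 - t) * a + t * b) *\<^sub>R (q - p)
        = (1 - t) *\<^sub>R (p + a *\<^sub>R (q - p)) + t *\<^sub>R (p + b *\<^sub>R (q - p))"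
      by (simp add: algebra_simps)
    with convex_onD[OF assms(1), of t "p + a *\<^sub>R (q - p)" "p + b *\<^sub>R (q - p)"] t
    show "\<phi> ((1 - t) *\<^sub>R a + t *\<^sub>R b) \<le> (1 - t) * \<phi> a + t * \<phi> b"
      by (simp add: \<phi>_def)
  qed simp
  moreover have "(\<phi> has_real_derivative (q - p) \<bullet> D) (at 0)"
    unfolding \<phi>_def by (rule GDERIV_along_line) (simp add: assms)
  ultimately have "(q - p) \<bullet> D * (1 - 0) \<le> \<phi> 1 - \<phi> 0"
    by (intro convex_on_imp_above_tangent) auto
  then show ?thesis by (simp add: \<phi>_def)
qed

text \<open>The Baillon-Haddad argument: the value at one auxiliary point is bounded below by the
  tangent at \<open>u\<close> and above by the quadratic at \<open>v\<close>. Adding the same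
  estimate with \<open>u\<close> and \<open>v\<close> exchanged removes the function values.\<close>

lemma gradient_cocoercive:
  fixes k :: "'a::real_inner \<Rightarrow> real"
  assumes lower: "\<And>u v. k u + (v - u) \<bullet> K u \<le> k v"
    and upper: "\<And>u v. k v \<le> k u + (v - u) \<bullet> K u + M / 2 * (norm (v - u))\<^sup>2"
    and M: "0 < M"
  shows "(norm (K u - K v))\<^sup>2 \<le> M * ((u - v) \<bullet> (K u - K v))"
proof -
  define G where "G = K u - K v"
  have half: "k u - k v \<le> (u - v) \<bullet> K u - (norm (K u - K v))\<^sup>2 / (2 * M)" for u v
  proof -
    define G where "G = K u - K v"
    \<comment> \<open>This displacement minimizes
      \<open>- (e \<bullet> G) + M / 2 * (norm e)\<^sup>2\<close>, the part of the comparison at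
      \<open>v + e\<close> that depends on \<open>e\<close>.\<close>
    define e where "e = (1 / M) *\<^sub>R G"
    have n: "(norm e)\<^sup>2 = (norm G)\<^sup>2 / M\<^sup>2"
      using M by (simp add: e_def power_divide)
    have "k u + (v + e - u) \<bullet> K u \<le> k v + e \<bullet> K v + M / 2 * (norm e)\<^sup>2"
      using lower[of u "v + e"] upper[of "v + e" v] by simp
    then have "k u - k v \<le> (u - v) \<bullet> K u - e \<bullet> G + M / 2 * (norm e)\<^sup>2"
      by (simp add: G_def algebra_simps inner_diff_right)
    also have "e \<bullet> G = (norm G)\<^sup>2 / M"
      by (simp add: e_def power2_norm_eq_inner)
    also have "M / 2 * (norm e)\<^sup>2 = (norm G)\<^sup>2 / M / 2"
      unfolding n using M by (simp add: power2_eq_square)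
    finally show ?thesis by (simp add: G_def)
  qed
  have "2 * ((norm G)\<^sup>2 / (2 * M)) \<le> (u - v) \<bullet> K u + (v - u) \<bullet> K v"
    using half[of u v] half[of v u] by (simp add: G_def norm_minus_commute)
  also have "\<dots> = (u - v) \<bullet> G" by (simp add: G_def algebra_simps inner_diff_right)
  finally show ?thesis using M by (simp add: G_def field_simps)
qed

subsection \<open>The Moreau value of a weakly convex function\<close>

text \<open>The difference quotient of the remainder is at most \<open>C * norm (q - p)\<close>,
  which tends to zero. This is how the Moreau value, an infimum, is shown to be
  differentiable.\<close>

lemma GDERIV_quadratic_remainder:
  fixes h :: "'a::euclidean_space \<Rightarrow> real"
  assumes "\<And>q. \<bar>h q - h p - (q - p) \<bullet> D\<bar> \<le> C * (norm (q - p))\<^sup>2"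
  shows "GDERIV h p :> D"
  unfolding gderiv_def
proof (rule has_derivativeI_sandwich)
  fix q assume "q \<noteq> p"
  then show "norm (h q - h p - (q - p) \<bullet> D) / norm (q - p) \<le> C * norm (q - p)"
    using assms[of q] by (simp add: field_simps power2_eq_square)
next
  have "((\<lambda>q. C * norm (q - p)) \<longlongrightarrow> C * norm (p - p)) (at p)"
    by (intro tendsto_intros)
  then show "((\<lambda>q. C * norm (q - p)) \<longlongrightarrow> 0) (at p)" by simp
qed (auto intro: bounded_linear_inner_left zero_less_one)

lemma lipschitz_smoothD:
  assumes "lipschitz_smooth L h"
  shows "GDERIV h p :> grad h p" "norm (grad h p - grad h q) \<le> L * norm (p - q)" "0 \<le> L"
  using assms lipschitz_onD[of L UNIV "grad h" p q]
  by (auto simp: lipschitz_smooth_def dist_norm intro: GDERIV_grad lipschitz_on_nonneg)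

text \<open>An exact second-order expansion, so quadratic terms can be added to the one-sided bounds
  on \<open>g\<close> without loss.\<close>

lemma half_norm_shift:
  fixes u v y :: "'a::real_inner"
  shows "r / 2 * (norm (v - y))\<^sup>2
    = r / 2 * (norm (u - y))\<^sup>2 + (v - u) \<bullet> (r *\<^sub>R (u - y)) + r / 2 * (norm (v - u))\<^sup>2"
proof -
  have "(norm (v - y))\<^sup>2 = (norm (u - y))\<^sup>2 + 2 * ((v - u) \<bullet> (u - y)) + (norm (v - u))\<^sup>2"
    by (simp add: power2_norm_eq_inner algebra_simps inner_commute)
  then show ?thesis by (simp add: distrib_left)
qed

lemma norm_fst_pair_le: "norm (fst p) \<le> norm p" for p :: "'a::real_normed_vector \<times> 'b::real_normed_vector"
  using norm_fst_le[of "fst p" "snd p"] by simp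

lemma norm_snd_pair_le: "norm (snd p) \<le> norm p" for p :: "'a::real_normed_vector \<times> 'b::real_normed_vector"
  using norm_snd_le[of "snd p" "fst p"] by simp

locale weakly_convex_lower =
  fixes g :: "'a::euclidean_space \<times> 'b::euclidean_space \<Rightarrow> real"
    and L \<rho>x \<rho> \<gamma> :: real
  assumes smooth_g: "lipschitz_smooth L g"
    and weakly_convex_g: "weakly_convex \<rho>x \<rho> g"
    and \<rho>_pos: "0 < \<rho>" and \<gamma>_pos: "0 < \<gamma>" and \<gamma>_small: "\<gamma> * \<rho> < 1"
begin

text \<open>The strong convexity modulus in \<open>\<theta>\<close> of the proximal objective: the
  curvature \<open>1 / \<gamma>\<close> of the quadratic less the \<open>\<rho>\<close> of weak
  convexity.\<close>

definition modulus :: real where "modulus = 1 / \<gamma> - \<rho>"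

definition prox_grad :: "'a \<times> 'b \<Rightarrow> 'b \<Rightarrow> 'b" where
  "prox_grad p \<theta> = snd (grad g (fst p, \<theta>)) + (1 / \<gamma>) *\<^sub>R (\<theta> - snd p)"

text \<open>The envelope formula: the gradient of the proximal objective in \<open>p\<close> at
  fixed \<open>\<theta>\<close>, evaluated at the minimizer. That it is the gradient of the Moreau
  value is proved in \<open>moreau_deriv\<close>.\<close>

definition moreau_grad :: "'a \<times> 'b \<Rightarrow> 'a \<times> 'b" where
  "moreau_grad p = (fst (grad g (fst p, prox_argmin g \<gamma> p)),
     (1 / \<gamma>) *\<^sub>R (snd p - prox_argmin g \<gamma> p))"

text \<open>A Lipschitz constant of the minimizer: the sensitivity \<open>L + 1 / \<gamma>\<close>
  of \<open>prox_grad\<close> to \<open>p\<close>, divided by the modulus.\<close>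

definition prox_lip :: real where "prox_lip = (L + 1 / \<gamma>) / modulus"

definition moreau_lip :: real where "moreau_lip = (L + 1 / \<gamma>) * (1 + prox_lip)"

lemmas g_deriv = lipschitz_smoothD(1)[OF smooth_g]
lemmas g_lip = lipschitz_smoothD(2)[OF smooth_g]
lemmas L_nonneg = lipschitz_smoothD(3)[OF smooth_g]

lemma modulus_pos: "0 < modulus"
  using \<gamma>_small \<gamma>_pos by (simp add: modulus_def field_simps)

lemma prox_lip_nonneg: "0 \<le> prox_lip"
  using L_nonneg \<gamma>_pos modulus_pos by (simp add: prox_lip_def)

lemma moreau_lip_nonneg: "0 \<le> moreau_lip"
  using L_nonneg \<gamma>_pos prox_lip_nonneg by (simp add: moreau_lip_def)

section \<open>Quadratic bounds for the proximal objective\<close>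

lemma slice_lip: "norm (snd (grad g (x, u)) - snd (grad g (x, v))) \<le> L * norm (u - v)"
proof -
  have "norm (snd (grad g (x, u) - grad g (x, v))) \<le> norm (grad g (x, u) - grad g (x, v))"
    by (rule norm_snd_pair_le)
  with g_lip[of "(x, u)" "(x, v)"] show ?thesis by (simp add: norm_Pair)
qed

lemma slice_upper:
  "g (x, v) \<le> g (x, u) + (v - u) \<bullet> snd (grad g (x, u)) + L / 2 * (norm (v - u))\<^sup>2"
  by (rule gradient_quadratic_upper[of "\<lambda>v. g (x, v)" "\<lambda>v. snd (grad g (x, v))"])
    (auto intro: GDERIV_snd_slice g_deriv slice_lip)

text \<open>Both points share \<open>x\<close>, so the \<open>\<rho>x\<close> terms cancel in the
  tangent inequality of the convexified function; expanding the \<open>\<rho>\<close> quadratic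
  about \<open>u\<close> leaves the error term.\<close>

lemma slice_lower:
  "g (x, v) \<ge> g (x, u) + (v - u) \<bullet> snd (grad g (x, u)) - \<rho> / 2 * (norm (v - u))\<^sup>2"
proof -
  let ?h = "\<lambda>(x, y). g (x, y) + \<rho>x / 2 * (norm x)\<^sup>2 + \<rho> / 2 * (norm y)\<^sup>2"
  have "GDERIV ?h (x, u) :> grad g (x, u) + (\<rho>x *\<^sub>R x, \<rho> *\<^sub>R u)"
    using g_deriv[of "(x, u)"] unfolding gderiv_def case_prod_unfold power2_norm_eq_inner
    by (auto intro!: derivative_eq_intros simp: inner_add_right inner_prod_def fun_eq_iff inner_commute)
  from convex_on_above_gradient[OF _ this, of "(x, v)"] weakly_convex_g
  have "g (x, u) + \<rho> / 2 * (norm u)\<^sup>2 + (v - u) \<bullet> (snd (grad g (x, u)) + \<rho> *\<^sub>R u)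
      \<le> g (x, v) + \<rho> / 2 * (norm v)\<^sup>2"
    by (simp add: weakly_convex_def inner_prod_def)
  moreover note half_norm_shift[of \<rho> v 0 u]
  ultimately show ?thesis
    unfolding inner_add_right diff_zero by linarith
qed

lemma prox_quadratic_shift:
  "1 / (2 * \<gamma>) * (norm (v - y))\<^sup>2
     = 1 / (2 * \<gamma>) * (norm (u - y))\<^sup>2 + (v - u) \<bullet> ((1 / \<gamma>) *\<^sub>R (u - y)) + 1 / \<gamma> / 2 * (norm (v - u))\<^sup>2"
  using half_norm_shift[of "1 / \<gamma>" v y u]
  by (simp only: divide_divide_eq_left mult.commute[of 2 \<gamma>])

lemma prox_upper:
  "prox_objective g \<gamma> p v
     \<le> prox_objective g \<gamma> p u + (v - u) \<bullet> prox_grad p u + (L + 1 / \<gamma>) / 2 * (norm (v - u))\<^sup>2"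
proof -
  have "(L + 1 / \<gamma>) / 2 * (norm (v - u))\<^sup>2 = L / 2 * (norm (v - u))\<^sup>2 + 1 / \<gamma> / 2 * (norm (v - u))\<^sup>2"
    by (simp only: add_divide_distrib distrib_right)
  with slice_upper[of "fst p" v u] prox_quadratic_shift[of v "snd p" u] show ?thesis
    unfolding prox_objective_def prox_grad_def inner_add_right by linarith
qed

lemma prox_lower:
  "prox_objective g \<gamma> p u + (v - u) \<bullet> prox_grad p u + modulus / 2 * (norm (v - u))\<^sup>2
     \<le> prox_objective g \<gamma> p v"
proof -
  have "modulus / 2 * (norm (v - u))\<^sup>2 = 1 / \<gamma> / 2 * (norm (v - u))\<^sup>2 - \<rho> / 2 * (norm (v - u))\<^sup>2"
    by (simp only: modulus_def diff_divide_distrib left_diff_distrib)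
  with slice_lower[of "fst p" u v] prox_quadratic_shift[of v "snd p" u] show ?thesis
    unfolding prox_objective_def prox_grad_def inner_add_right by linarith
qed

section \<open>The proximal point: existence, dependence on the data, contraction\<close>

lemma continuous_prox_objective: "continuous_on S (prox_objective g \<gamma> p)"
proof -
  have "continuous_on UNIV g"
    using g_deriv by (auto intro!: continuous_at_imp_continuous_on has_derivative_continuous
        simp: gderiv_def)
  then have "continuous_on S (\<lambda>\<theta>. g (fst p, \<theta>))"
    by (rule continuous_on_compose2) (intro continuous_intros, simp)
  then show ?thesis unfolding prox_objective_def[abs_def]
    by (intro continuous_intros)
qed

text \<open>Coercivity: outside a ball the strong convexity term at \<open>0\<close> dominates the
  linear one, so a minimizer over the compact ball is global.\<close>

lemma prox_minimizer_exists: "\<exists>\<theta>. \<forall>v. prox_objective g \<gamma> p \<theta> \<le> prox_objective g \<gamma> p v"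
proof -
  let ?h = "prox_objective g \<gamma> p"
  \<comment> \<open>The radius beyond which \<open>modulus / 2 * (norm v)\<^sup>2\<close> exceeds
    \<open>norm v * norm (prox_grad p 0)\<close>.\<close>
  define R where "R = 2 * norm (prox_grad p 0) / modulus"
  have "0 \<le> R" using modulus_pos by (simp add: R_def)
  then have "cball 0 R \<noteq> ({} :: 'b set)" by simp
  then have "\<exists>\<theta>\<in>cball 0 R. \<forall>v\<in>cball 0 R. ?h \<theta> \<le> ?h v"
    by (intro continuous_attains_inf compact_cball continuous_prox_objective)
  then obtain \<theta> where min: "\<forall>v\<in>cball 0 R. ?h \<theta> \<le> ?h v" by blast
  have \<theta>: "?h \<theta> \<le> ?h v" if "norm v \<le> R" for v
    using bspec[OF min, of v] that by (simp only: mem_cball_0)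
  have "?h \<theta> \<le> ?h v" for v
  proof (cases "norm v \<le> R")
    case False
    have "norm v * norm (prox_grad p 0) = norm v * (modulus / 2 * R)"
      using modulus_pos by (simp add: R_def)
    also have "\<dots> \<le> norm v * (modulus / 2 * norm v)"
      using False modulus_pos by (intro mult_left_mono) auto
    also have "\<dots> = modulus / 2 * (norm v)\<^sup>2"
      by (simp add: power2_eq_square)
    finally have "norm v * norm (prox_grad p 0) \<le> modulus / 2 * (norm v)\<^sup>2" .
    with Cauchy_Schwarz_ineq2[of v "prox_grad p 0"]
    have nonneg: "0 \<le> v \<bullet> prox_grad p 0 + modulus / 2 * (norm v)\<^sup>2"
      by arith
    have "?h \<theta> \<le> ?h 0"
      using \<open>0 \<le> R\<close> by (intro \<theta>) simp
    also have "\<dots> \<le> ?h 0 + (v \<bullet> prox_grad p 0 + modulus / 2 * (norm v)\<^sup>2)"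
      using nonneg by (simp only: le_add_same_cancel1)
    also have "\<dots> \<le> ?h v"
      using prox_lower[of p 0 v] by (simp only: diff_zero add.assoc)
    finally show ?thesis .
  qed (rule \<theta>)
  then show ?thesis by (intro exI allI)
qed

lemma prox_argmin_le: "prox_objective g \<gamma> p (prox_argmin g \<gamma> p) \<le> prox_objective g \<gamma> p v"
proof -
  have "\<exists>\<theta>. is_arg_min (prox_objective g \<gamma> p) (\<lambda>_. True) \<theta>"
    using prox_minimizer_exists[of p] by (simp only: is_arg_min_linorder simp_thms)
  then have "is_arg_min (prox_objective g \<gamma> p) (\<lambda>_. True) (prox_argmin g \<gamma> p)"
    unfolding prox_argmin_def arg_min_def by (rule someI_ex)
  then show ?thesis by (simp only: is_arg_min_linorder simp_thms)
qed

lemma moreau_value_eq: "moreau_value g \<gamma> p = prox_objective g \<gamma> p (prox_argmin g \<gamma> p)"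
  unfolding moreau_value_def
proof (rule cInf_eq_minimum)
  fix r assume "r \<in> range (prox_objective g \<gamma> p)"
  then obtain v where "r = prox_objective g \<gamma> p v" by blast
  then show "prox_objective g \<gamma> p (prox_argmin g \<gamma> p) \<le> r" by (simp only: prox_argmin_le)
qed (rule rangeI)

lemma gap_nonneg: "0 \<le> gap g \<gamma> p"
proof -
  have "prox_objective g \<gamma> p (snd p) = g p" by (simp add: prox_objective_def)
  with prox_argmin_le[of p "snd p"] show ?thesis by (simp only: gap_def moreau_value_eq diff_ge_0_iff_ge)
qed

text \<open>A gradient step of length \<open>1 / (L + 1 / \<gamma>)\<close> from the minimizer would
  lower the objective by at least \<open>c * n / 2\<close>, so minimality forces the squared
  gradient norm \<open>n\<close> to vanish.\<close>

lemma prox_grad_argmin: "prox_grad p (prox_argmin g \<gamma> p) = 0"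
proof -
  let ?\<theta> = "prox_argmin g \<gamma> p"
  define G where "G = prox_grad p ?\<theta>"
  define B where "B = L + 1 / \<gamma>"
  define c where "c = 1 / B"
  have "0 < B"
    unfolding B_def using L_nonneg \<gamma>_pos by (intro add_nonneg_pos) auto
  then have c: "0 < c" "B * c = 1" by (simp_all add: c_def)
  define n where "n = (norm G)\<^sup>2"
  have "prox_objective g \<gamma> p (?\<theta> - c *\<^sub>R G)
      \<le> prox_objective g \<gamma> p ?\<theta> + (- (c *\<^sub>R G)) \<bullet> G + B / 2 * (norm (- (c *\<^sub>R G)))\<^sup>2"
  proof -
    have "?\<theta> - c *\<^sub>R G - ?\<theta> = - (c *\<^sub>R G)" by simp
    with prox_upper[of p "?\<theta> - c *\<^sub>R G" ?\<theta>, folded G_def B_def] show ?thesis by (simp only:)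
  qed
  also have "(- (c *\<^sub>R G)) \<bullet> G = - (c * n)"
    by (simp only: n_def power2_norm_eq_inner inner_minus_left inner_scaleR_left)
  also have "(norm (- (c *\<^sub>R G)))\<^sup>2 = c\<^sup>2 * n"
    by (simp only: n_def norm_minus_cancel norm_scaleR power_mult_distrib power2_abs)
  also have "B / 2 * (c\<^sup>2 * n) = (B * c) * (c * n) / 2"
    by (simp only: power2_eq_square times_divide_eq_left mult.assoc)
  also have "\<dots> = c * n / 2"
    by (simp only: c(2) mult_1)
  finally have "c * n \<le> 0"
    using prox_argmin_le[of p "?\<theta> - c *\<^sub>R G"] by linarith
  then show ?thesis using c(1) by (simp add: G_def n_def mult_le_0_iff)
qed

lemma prox_strongly_monotone:
  "modulus * (norm (u - v))\<^sup>2 \<le> (u - v) \<bullet> (prox_grad p u - prox_grad p v)"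
  using prox_lower[of p u v] prox_lower[of p v u]
  by (simp add: norm_minus_commute algebra_simps inner_diff_right)

text \<open>At the minimizer for \<open>q\<close> the field \<open>prox_grad q\<close> vanishes, so
  \<open>prox_grad p\<close> there measures only the change of data; strong monotonicity turns this
  into a distance between minimizers.\<close>

lemma prox_argmin_lipschitz:
  "norm (prox_argmin g \<gamma> p - prox_argmin g \<gamma> q) \<le> prox_lip * norm (p - q)"
proof -
  let ?u = "prox_argmin g \<gamma> p" and ?v = "prox_argmin g \<gamma> q"
  have "prox_grad p ?v = snd (grad g (fst p, ?v) - grad g (fst q, ?v)) - (1 / \<gamma>) *\<^sub>R snd (p - q)"
    using prox_grad_argmin[of q] by (simp add: prox_grad_def algebra_simps eq_neg_iff_add_eq_0)
  also have "norm \<dots> \<le> L * norm (p - q) + 1 / \<gamma> * norm (p - q)"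
  proof (rule norm_triangle_le_diff, rule add_mono)
    have "norm (snd (grad g (fst p, ?v) - grad g (fst q, ?v))) \<le> L * norm (fst (p - q))"
      using norm_snd_pair_le[of "grad g (fst p, ?v) - grad g (fst q, ?v)"] g_lip[of "(fst p, ?v)" "(fst q, ?v)"]
      by (simp add: norm_Pair)
    also have "\<dots> \<le> L * norm (p - q)"
      by (intro mult_left_mono norm_fst_pair_le L_nonneg)
    finally show "norm (snd (grad g (fst p, ?v) - grad g (fst q, ?v))) \<le> L * norm (p - q)" .
    show "norm ((1 / \<gamma>) *\<^sub>R snd (p - q)) \<le> 1 / \<gamma> * norm (p - q)"
      using \<gamma>_pos norm_snd_pair_le[of "p - q"] by (simp add: divide_right_mono)
  qed
  finally have bound: "norm (prox_grad p ?v) \<le> (L + 1 / \<gamma>) * norm (p - q)"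
    by (simp add: algebra_simps)
  have "modulus * (norm (?u - ?v))\<^sup>2 \<le> norm (?u - ?v) * norm (prox_grad p ?v)"
    using prox_strongly_monotone[of ?u ?v p] norm_cauchy_schwarz[of "?u - ?v" "- prox_grad p ?v"]
    by (simp add: prox_grad_argmin)
  then have "norm (?u - ?v) * (modulus * norm (?u - ?v)) \<le> norm (?u - ?v) * norm (prox_grad p ?v)"
    by (simp add: power2_eq_square mult_ac)
  then have "modulus * norm (?u - ?v) \<le> norm (prox_grad p ?v)"
    by (cases "?u = ?v") (simp_all del: mult_le_cancel_left add: mult_le_cancel_left_pos)
  with bound show ?thesis using modulus_pos by (simp add: prox_lip_def field_simps)
qed

text \<open>The difference of \<open>prox_grad\<close> splits into \<open>a\<close>, coming from the
  gradient \<open>K\<close> of a convex function, and \<open>modulus\<close> times \<open>d\<close>.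
  Cocoercivity trades the squared norm of \<open>a\<close> for \<open>d \<bullet> a\<close>, whose
  total coefficient is nonpositive by the bound on \<open>\<alpha>\<close>.\<close>

lemma prox_step_contraction:
  assumes \<alpha>: "0 \<le> \<alpha>" "\<alpha> * (L - \<rho> + 2 / \<gamma>) \<le> 2"
  shows "(norm (\<theta> - \<alpha> *\<^sub>R prox_grad p \<theta> - prox_argmin g \<gamma> p))\<^sup>2
    \<le> (1 - \<alpha> * modulus)\<^sup>2 * (norm (\<theta> - prox_argmin g \<gamma> p))\<^sup>2"
proof -
  let ?v = "prox_argmin g \<gamma> p"
  define K where "K u = snd (grad g (fst p, u)) + \<rho> *\<^sub>R u" for u
  define d a where "d = \<theta> - ?v" and "a = K \<theta> - K ?v"
  let ?k = "\<lambda>u. g (fst p, u) + \<rho> / 2 * (norm u)\<^sup>2"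
  have coco: "(norm a)\<^sup>2 \<le> (L + \<rho>) * (d \<bullet> a)"
    unfolding a_def d_def
  proof (rule gradient_cocoercive)
    show "?k u + (v - u) \<bullet> K u \<le> ?k v" for u v
      using slice_lower[of "fst p" u v] half_norm_shift[of \<rho> v 0 u, unfolded diff_zero]
      unfolding K_def inner_add_right by linarith
    show "?k v \<le> ?k u + (v - u) \<bullet> K u + (L + \<rho>) / 2 * (norm (v - u))\<^sup>2" for u v
      using slice_upper[of "fst p" v u] half_norm_shift[of \<rho> v 0 u, unfolded diff_zero]
      unfolding K_def inner_add_right add_divide_distrib distrib_right by linarith
    show "0 < L + \<rho>" using L_nonneg \<rho>_pos by simp
  qed
  have da: "0 \<le> d \<bullet> a"
    using order_trans[OF zero_le_power2 coco] L_nonneg \<rho>_pos by (simp add: zero_le_mult_iff)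
  have "prox_grad p \<theta> = prox_grad p \<theta> - prox_grad p ?v" by (simp add: prox_grad_argmin)
  also have "\<dots> = a + modulus *\<^sub>R d"
    by (simp add: prox_grad_def a_def d_def K_def modulus_def algebra_simps)
  finally have "\<theta> - \<alpha> *\<^sub>R prox_grad p \<theta> - ?v = d - \<alpha> *\<^sub>R (a + modulus *\<^sub>R d)"
    by (simp add: d_def)
  also have "\<dots> = (1 - \<alpha> * modulus) *\<^sub>R d - \<alpha> *\<^sub>R a"
    by (simp add: algebra_simps)
  finally have "\<theta> - \<alpha> *\<^sub>R prox_grad p \<theta> - ?v = (1 - \<alpha> * modulus) *\<^sub>R d - \<alpha> *\<^sub>R a" .
  moreover have "(norm (k *\<^sub>R d - \<alpha> *\<^sub>R a))\<^sup>2
      = k\<^sup>2 * (norm d)\<^sup>2 - 2 * \<alpha> * k * (d \<bullet> a) + \<alpha>\<^sup>2 * (norm a)\<^sup>2" for k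
    unfolding power2_norm_eq_inner
    by (simp add: inner_diff_left inner_diff_right inner_commute power2_eq_square right_diff_distrib)
  ultimately have "(norm (\<theta> - \<alpha> *\<^sub>R prox_grad p \<theta> - ?v))\<^sup>2
      = (1 - \<alpha> * modulus)\<^sup>2 * (norm d)\<^sup>2 - 2 * \<alpha> * (1 - \<alpha> * modulus) * (d \<bullet> a) + \<alpha>\<^sup>2 * (norm a)\<^sup>2"
    by (simp only:)
  also have "\<dots> \<le> (1 - \<alpha> * modulus)\<^sup>2 * (norm d)\<^sup>2 - 2 * \<alpha> * (1 - \<alpha> * modulus) * (d \<bullet> a)
      + \<alpha>\<^sup>2 * ((L + \<rho>) * (d \<bullet> a))"
    by (intro add_left_mono mult_left_mono coco) simp
  also have "\<dots> = (1 - \<alpha> * modulus)\<^sup>2 * (norm d)\<^sup>2 + \<alpha> * (\<alpha> * (L - \<rho> + 2 / \<gamma>) - 2) * (d \<bullet> a)"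
    by (simp add: modulus_def power2_eq_square algebra_simps)
  also have "\<dots> \<le> (1 - \<alpha> * modulus)\<^sup>2 * (norm d)\<^sup>2"
    using mult_nonpos_nonneg[OF mult_nonneg_nonpos[of \<alpha> "\<alpha> * (L - \<rho> + 2 / \<gamma>) - 2"] da] \<alpha> by simp
  finally show ?thesis by (simp add: d_def)
qed

section \<open>Smoothness of the Moreau value\<close>

lemma prox_objective_upper:
  "prox_objective g \<gamma> q \<theta> \<le> prox_objective g \<gamma> p \<theta>
     + (q - p) \<bullet> (fst (grad g (fst p, \<theta>)), (1 / \<gamma>) *\<^sub>R (snd p - \<theta>)) + (L + 1 / \<gamma>) / 2 * (norm (q - p))\<^sup>2"
proof -
  have "L / 2 * (norm (fst q - fst p))\<^sup>2 \<le> L / 2 * (norm (q - p))\<^sup>2"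
    using norm_fst_pair_le[of "q - p"] L_nonneg by (intro mult_left_mono power_mono) auto
  moreover have "1 / \<gamma> / 2 * (norm (snd q - snd p))\<^sup>2 \<le> 1 / \<gamma> / 2 * (norm (q - p))\<^sup>2"
    using norm_snd_pair_le[of "q - p"] \<gamma>_pos by (intro mult_left_mono power_mono) auto
  moreover have "g (fst q, \<theta>) \<le> g (fst p, \<theta>) + (fst q - fst p) \<bullet> fst (grad g (fst p, \<theta>))
      + L / 2 * (norm (fst q - fst p))\<^sup>2"
    using gradient_quadratic_upper[of g "grad g" L "(fst q, \<theta>)" "(fst p, \<theta>)", OF g_deriv g_lip]
    by (simp add: inner_prod_def norm_Pair)
  moreover have "1 / (2 * \<gamma>) * (norm (\<theta> - snd q))\<^sup>2 = 1 / (2 * \<gamma>) * (norm (\<theta> - snd p))\<^sup>2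
      + (snd q - snd p) \<bullet> ((1 / \<gamma>) *\<^sub>R (snd p - \<theta>)) + 1 / \<gamma> / 2 * (norm (snd q - snd p))\<^sup>2"
    using prox_quadratic_shift[of "snd q" \<theta> "snd p"] by (simp add: norm_minus_commute)
  ultimately show ?thesis
    unfolding prox_objective_def by (simp add: inner_prod_def algebra_simps add_divide_distrib)
qed

text \<open>The minimizer at \<open>p\<close> is a competitor at \<open>q\<close>, so the bound for
  the objective at fixed \<open>\<theta>\<close> carries over.\<close>

lemma moreau_upper:
  "moreau_value g \<gamma> q \<le> moreau_value g \<gamma> p + (q - p) \<bullet> moreau_grad p + (L + 1 / \<gamma>) / 2 * (norm (q - p))\<^sup>2"
  using prox_objective_upper[of q "prox_argmin g \<gamma> p" p] prox_argmin_le[of q "prox_argmin g \<gamma> p"]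
  by (simp add: moreau_value_eq moreau_grad_def)

lemma moreau_grad_lipschitz: "norm (moreau_grad p - moreau_grad q) \<le> moreau_lip * norm (p - q)"
proof -
  let ?u = "prox_argmin g \<gamma> p" and ?v = "prox_argmin g \<gamma> q"
  have "norm (moreau_grad p - moreau_grad q)
      \<le> norm (fst (grad g (fst p, ?u) - grad g (fst q, ?v))) + norm ((1 / \<gamma>) *\<^sub>R (snd (p - q) - (?u - ?v)))"
    by (rule order_trans[OF _ norm_Pair_le]) (simp add: moreau_grad_def algebra_simps)
  also have "\<dots> \<le> L * (norm (p - q) + norm (?u - ?v)) + 1 / \<gamma> * (norm (p - q) + norm (?u - ?v))"
  proof (rule add_mono)
    have "norm (fst (grad g (fst p, ?u) - grad g (fst q, ?v))) \<le> L * norm (fst (p - q), ?u - ?v)"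
      using norm_fst_pair_le[of "grad g (fst p, ?u) - grad g (fst q, ?v)"] g_lip[of "(fst p, ?u)" "(fst q, ?v)"]
      by simp
    also have "\<dots> \<le> L * (norm (p - q) + norm (?u - ?v))"
      using norm_Pair_le[of "fst (p - q)" "?u - ?v"] norm_fst_pair_le[of "p - q"] L_nonneg
      by (intro mult_left_mono) auto
    finally show "norm (fst (grad g (fst p, ?u) - grad g (fst q, ?v))) \<le> L * (norm (p - q) + norm (?u - ?v))" .
    have "norm (snd (p - q) - (?u - ?v)) \<le> norm (p - q) + norm (?u - ?v)"
      using norm_triangle_ineq4[of "snd (p - q)" "?u - ?v"] norm_snd_pair_le[of "p - q"] by linarith
    then show "norm ((1 / \<gamma>) *\<^sub>R (snd (p - q) - (?u - ?v))) \<le> 1 / \<gamma> * (norm (p - q) + norm (?u - ?v))"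
      using \<gamma>_pos by (simp add: divide_right_mono)
  qed
  also have "\<dots> = (L + 1 / \<gamma>) * (norm (p - q) + norm (?u - ?v))" by (simp add: algebra_simps)
  also have "\<dots> \<le> (L + 1 / \<gamma>) * (norm (p - q) + prox_lip * norm (p - q))"
    using L_nonneg \<gamma>_pos by (intro mult_left_mono add_left_mono prox_argmin_lipschitz) simp
  finally show ?thesis by (simp add: moreau_lip_def algebra_simps)
qed

text \<open>One side is \<open>moreau_upper\<close>. With \<open>p\<close> and \<open>q\<close>
  exchanged it gives the other side with the gradient at \<open>q\<close>, which
  \<open>moreau_grad_lipschitz\<close> moves to \<open>p\<close> at quadratic cost.\<close>

lemma moreau_deriv: "GDERIV (moreau_value g \<gamma>) p :> moreau_grad p"
proof (rule GDERIV_quadratic_remainder)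
  fix q
  let ?n = "(norm (q - p))\<^sup>2" and ?v = "moreau_value g \<gamma>"
  have "(q - p) \<bullet> (moreau_grad p - moreau_grad q) \<le> norm (q - p) * norm (moreau_grad p - moreau_grad q)"
    by (rule norm_cauchy_schwarz)
  also have "\<dots> \<le> norm (q - p) * (moreau_lip * norm (q - p))"
    using moreau_grad_lipschitz[of p q] by (intro mult_left_mono) (auto simp: norm_minus_commute)
  also have "\<dots> = moreau_lip * ?n" by (simp add: power2_eq_square)
  finally have "- (moreau_lip * ?n + (L + 1 / \<gamma>) / 2 * ?n) \<le> ?v q - ?v p - (q - p) \<bullet> moreau_grad p"
    using moreau_upper[of p q] by (simp add: norm_minus_commute inner_diff_left inner_diff_right)
  moreover have "?v q - ?v p - (q - p) \<bullet> moreau_grad p \<le> moreau_lip * ?n + (L + 1 / \<gamma>) / 2 * ?n"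
    using moreau_upper[of q p] mult_nonneg_nonneg[OF moreau_lip_nonneg, of ?n] by simp
  ultimately show "\<bar>?v q - ?v p - (q - p) \<bullet> moreau_grad p\<bar> \<le> (moreau_lip + (L + 1 / \<gamma>) / 2) * ?n"
    unfolding distrib_right by linarith
qed

end

subsection \<open>Descent of the penalized objective\<close>

text \<open>The error \<open>e\<close> enters only through the pairing with \<open>s\<close>, not as
  \<open>s = G p + e\<close>. A step in one block of variables, with the other component of
  \<open>s\<close> zero, therefore qualifies.\<close>

lemma inexact_gradient_step:
  fixes h :: "'a::real_inner \<Rightarrow> real"
  assumes deriv: "\<And>p. GDERIV h p :> G p"
    and lip: "\<And>p q. norm (G p - G q) \<le> \<Lambda> * norm (p - q)"
    and s: "s \<bullet> G p = s \<bullet> (s - e)"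
    and a: "0 \<le> a" "a * \<Lambda> \<le> 1 / 2"
  shows "h (p - a *\<^sub>R s) \<le> h p - a / 4 * (norm s)\<^sup>2 + a / 2 * (norm e)\<^sup>2"
proof -
  have "0 \<le> (norm (s - e))\<^sup>2" by simp
  then have "s \<bullet> e \<le> (norm s)\<^sup>2 / 2 + (norm e)\<^sup>2 / 2"
    by (simp add: power2_norm_eq_inner algebra_simps inner_commute)
  then have "(norm s)\<^sup>2 / 2 - (norm e)\<^sup>2 / 2 \<le> s \<bullet> G p"
    unfolding s by (simp add: inner_diff_right power2_norm_eq_inner)
  then have descent: "a * ((norm s)\<^sup>2 / 2 - (norm e)\<^sup>2 / 2) \<le> a * (s \<bullet> G p)"
    using a by (intro mult_left_mono)
  have "a * \<Lambda> * (a * (norm s)\<^sup>2) \<le> 1 / 2 * (a * (norm s)\<^sup>2)"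
    using a by (intro mult_right_mono) auto
  then have "\<Lambda> / 2 * (norm (a *\<^sub>R s))\<^sup>2 \<le> a / 4 * (norm s)\<^sup>2"
    by (simp add: power_mult_distrib power2_eq_square mult_ac)
  moreover have "h (p - a *\<^sub>R s) \<le> h p - a * (s \<bullet> G p) + \<Lambda> / 2 * (norm (a *\<^sub>R s))\<^sup>2"
    using gradient_quadratic_upper[OF deriv lip, of "p - a *\<^sub>R s" p] by simp
  ultimately show ?thesis using descent by (simp add: algebra_simps)
qed

text \<open>Young's inequality; the free \<open>\<delta>\<close> allows the factor on the first term
  to stay close to one.\<close>

lemma power2_norm_add_le:
  fixes a b :: "'a::real_inner"
  assumes "0 < \<delta>"
  shows "(norm (a + b))\<^sup>2 \<le> (1 + \<delta>) * (norm a)\<^sup>2 + (1 + 1 / \<delta>) * (norm b)\<^sup>2"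
proof -
  have "0 \<le> \<delta> * (norm (a - (1 / \<delta>) *\<^sub>R b))\<^sup>2" using assms by simp
  also have "\<dots> = \<delta> * (norm a)\<^sup>2 - 2 * (a \<bullet> b) + 1 / \<delta> * (norm b)\<^sup>2"
    using assms by (simp add: power2_norm_eq_inner inner_diff_left inner_diff_right inner_commute
        right_diff_distrib distrib_left)
  finally show ?thesis
    by (simp add: power2_norm_eq_inner inner_add_left inner_add_right inner_commute distrib_right)
qed

section \<open>The penalized objective divided by the penalty\<close>

locale penalized_lower = weakly_convex_lower g L \<rho>x \<rho> \<gamma>
  for g :: "'a::euclidean_space \<times> 'b::euclidean_space \<Rightarrow> real" and L \<rho>x \<rho> \<gamma> +
  fixes F :: "'a \<times> 'b \<Rightarrow> real" and LF Flow c0 :: real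
  assumes smooth_F: "lipschitz_smooth LF F"
    and F_lower: "\<And>p. Flow \<le> F p"
    and c0_pos: "0 < c0"
begin

text \<open>Division by \<open>c\<close> matches the factor \<open>1 / c\<close> in the search
  directions and keeps the Lipschitz constant of the gradient bounded as \<open>c\<close>
  grows.\<close>

definition merit :: "real \<Rightarrow> 'a \<times> 'b \<Rightarrow> real" where
  "merit c p = penalized F Flow g \<gamma> c p / c"

definition merit_grad :: "real \<Rightarrow> 'a \<times> 'b \<Rightarrow> 'a \<times> 'b" where
  "merit_grad c p = (1 / c) *\<^sub>R grad F p + (grad g p - moreau_grad p)"

text \<open>Formed with \<open>c0\<close>, hence valid for all penalties \<open>c \<ge> c0\<close>
  at once.\<close>

definition merit_lip :: real where "merit_lip = LF / c0 + (L + moreau_lip)"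

lemmas F_deriv = lipschitz_smoothD(1)[OF smooth_F]
lemmas F_lip = lipschitz_smoothD(2)[OF smooth_F]
lemmas LF_nonneg = lipschitz_smoothD(3)[OF smooth_F]

lemma merit_lip_nonneg: "0 \<le> merit_lip"
  using LF_nonneg L_nonneg moreau_lip_nonneg c0_pos by (simp add: merit_lip_def)

lemma merit_eq: "0 < c \<Longrightarrow> merit c p = (F p - Flow) / c + gap g \<gamma> p"
  by (simp add: merit_def penalized_def add_divide_distrib)

lemma gap_le_merit: "0 < c \<Longrightarrow> gap g \<gamma> p \<le> merit c p"
  using F_lower[of p] by (simp add: merit_eq)

text \<open>A larger penalty shrinks the nonnegative term \<open>(F p - Flow) / c\<close>, so an
  increasing penalty preserves descent.\<close>

lemma merit_antimono: "0 < c \<Longrightarrow> c \<le> c' \<Longrightarrow> merit c' p \<le> merit c p"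
  using F_lower[of p] by (simp add: merit_eq divide_left_mono)

lemma merit_deriv: "0 < c \<Longrightarrow> GDERIV (merit c) p :> merit_grad c p"
  using F_deriv[of p] g_deriv[of p] moreau_deriv[of p]
  unfolding merit_def penalized_def gap_def gderiv_def merit_grad_def
  by (auto intro!: derivative_eq_intros simp: fun_eq_iff inner_add_right inner_diff_right field_simps)

lemma merit_grad_lipschitz:
  assumes "c0 \<le> c"
  shows "norm (merit_grad c p - merit_grad c q) \<le> merit_lip * norm (p - q)"
proof -
  have c: "0 < c" using assms c0_pos by simp
  have "merit_grad c p - merit_grad c q = (1 / c) *\<^sub>R (grad F p - grad F q)
      + ((grad g p - grad g q) - (moreau_grad p - moreau_grad q))"
    by (simp add: merit_grad_def algebra_simps)
  also have "norm \<dots> \<le> LF / c0 * norm (p - q) + (L * norm (p - q) + moreau_lip * norm (p - q))"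
  proof (rule norm_triangle_mono[OF _ norm_triangle_le_diff[OF add_mono[OF g_lip moreau_grad_lipschitz]]])
    have "norm ((1 / c) *\<^sub>R (grad F p - grad F q)) \<le> 1 / c * (LF * norm (p - q))"
      using c F_lip[of p q] by (simp add: divide_right_mono)
    also have "\<dots> \<le> 1 / c0 * (LF * norm (p - q))"
      using assms c0_pos LF_nonneg by (intro mult_right_mono divide_left_mono) auto
    finally show "norm ((1 / c) *\<^sub>R (grad F p - grad F q)) \<le> LF / c0 * norm (p - q)" by simp
  qed
  finally show ?thesis by (simp add: merit_lip_def algebra_simps)
qed

section \<open>Search directions as inexact gradients\<close>

definition x_dir :: "real \<Rightarrow> 'a \<Rightarrow> 'b \<Rightarrow> 'b \<Rightarrow> 'a" where
  "x_dir c x y \<theta> = (1 / c) *\<^sub>R grad_x F x y + grad_x g x y - grad_x g x \<theta>"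

definition y_dir :: "real \<Rightarrow> 'a \<Rightarrow> 'b \<Rightarrow> 'b \<Rightarrow> 'b" where
  "y_dir c x y \<theta> = (1 / c) *\<^sub>R grad_y F x y + grad_y g x y + (1 / \<gamma>) *\<^sub>R (\<theta> - y)"

text \<open>The direction uses \<open>\<theta>\<close> where the Moreau gradient uses the exact
  minimizer; all other terms cancel.\<close>

lemma x_dir_error:
  "norm (x_dir c x y \<theta> - fst (merit_grad c (x, y))) \<le> L * norm (\<theta> - prox_argmin g \<gamma> (x, y))"
proof -
  let ?v = "prox_argmin g \<gamma> (x, y)"
  have "x_dir c x y \<theta> - fst (merit_grad c (x, y)) = fst (grad g (x, ?v) - grad g (x, \<theta>))"
    by (simp add: x_dir_def merit_grad_def moreau_grad_def grad_x_eq[OF F_deriv] grad_x_eq[OF g_deriv])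
  also have "norm \<dots> \<le> L * norm (\<theta> - ?v)"
    using norm_fst_pair_le[of "grad g (x, ?v) - grad g (x, \<theta>)"] g_lip[of "(x, ?v)" "(x, \<theta>)"]
    by (simp add: norm_Pair norm_minus_commute)
  finally show ?thesis .
qed

lemma y_dir_error:
  "norm (y_dir c x y \<theta> - snd (merit_grad c (x, y))) = 1 / \<gamma> * norm (\<theta> - prox_argmin g \<gamma> (x, y))"
proof -
  have "y_dir c x y \<theta> - snd (merit_grad c (x, y)) = (1 / \<gamma>) *\<^sub>R (\<theta> - prox_argmin g \<gamma> (x, y))"
    by (simp add: y_dir_def merit_grad_def moreau_grad_def grad_y_eq[OF F_deriv] grad_y_eq[OF g_deriv]
        algebra_simps)
  then show ?thesis using \<gamma>_pos by simp
qed

section \<open>One outer iteration\<close>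

context
  fixes c ax ay :: real and x x' :: 'a and y y' \<theta> :: 'b and dx dy e
  assumes c: "c0 \<le> c"
    and dx: "dx = x_dir c x y \<theta>" and x': "x' = x - ax *\<^sub>R dx"
    and dy: "dy = y_dir c x' y \<theta>" and y': "y' = y - ay *\<^sub>R dy"
    and ax: "0 \<le> ax" "ax * merit_lip \<le> 1 / 2"
    and ay: "0 \<le> ay" "ay * merit_lip \<le> 1 / 2"
  defines "e \<equiv> norm (\<theta> - prox_argmin g \<gamma> (x, y))"
begin

text \<open>The \<open>y\<close>-direction is evaluated after the \<open>x\<close>-step, while
  \<open>e\<close> is measured before it; in between the minimizer moves by at most
  \<open>prox_lip\<close> times the \<open>x\<close>-step.\<close>

lemma half_step_prox_drift:
  "norm (\<theta> - prox_argmin g \<gamma> (x', y)) \<le> e + prox_lip * (ax * norm dx)"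
proof -
  have "norm (prox_argmin g \<gamma> (x, y) - prox_argmin g \<gamma> (x', y)) \<le> prox_lip * (ax * norm dx)"
    using prox_argmin_lipschitz[of "(x, y)" "(x', y)"] ax by (simp add: x' norm_Pair)
  then show ?thesis
    using norm_triangle_ineq[of "\<theta> - prox_argmin g \<gamma> (x, y)"
        "prox_argmin g \<gamma> (x, y) - prox_argmin g \<gamma> (x', y)"] by (simp add: e_def)
qed

text \<open>Two inexact block steps in succession, the second from the half-updated point
  \<open>(x', y)\<close>. Its error picks up the drift of the minimizer, which gives the last
  term.\<close>

lemma merit_descent:
  "merit c (x', y') \<le> merit c (x, y) - ax / 4 * (norm dx)\<^sup>2 - ay / 4 * (norm dy)\<^sup>2
     + (ax * L\<^sup>2 / 2 + ay / \<gamma>\<^sup>2) * e\<^sup>2 + ay / \<gamma>\<^sup>2 * (prox_lip * (ax * norm dx))\<^sup>2"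
proof -
  have cpos: "0 < c" using c c0_pos by simp
  note step = inexact_gradient_step[OF merit_deriv[OF cpos] merit_grad_lipschitz[OF c]]
  define ex where "ex = dx - fst (merit_grad c (x, y))"
  define ey where "ey = dy - snd (merit_grad c (x', y))"
  have "merit c ((x, y) - ax *\<^sub>R (dx, 0))
      \<le> merit c (x, y) - ax / 4 * (norm (dx, 0 :: 'b))\<^sup>2 + ax / 2 * (norm (ex, 0 :: 'b))\<^sup>2"
    by (rule step[OF _ ax]) (simp add: ex_def inner_prod_def)
  then have X: "merit c (x', y) \<le> merit c (x, y) - ax / 4 * (norm dx)\<^sup>2 + ax / 2 * (norm ex)\<^sup>2"
    by (simp add: x' norm_Pair)
  have "merit c ((x', y) - ay *\<^sub>R (0, dy))
      \<le> merit c (x', y) - ay / 4 * (norm (0 :: 'a, dy))\<^sup>2 + ay / 2 * (norm (0 :: 'a, ey))\<^sup>2"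
    by (rule step[OF _ ay]) (simp add: ey_def inner_prod_def)
  then have Y: "merit c (x', y') \<le> merit c (x', y) - ay / 4 * (norm dy)\<^sup>2 + ay / 2 * (norm ey)\<^sup>2"
    by (simp add: y' norm_Pair)
  have "(norm ex)\<^sup>2 \<le> (L * e)\<^sup>2"
    unfolding ex_def dx e_def by (intro power_mono x_dir_error norm_ge_zero)
  then have ex: "ax / 2 * (norm ex)\<^sup>2 \<le> ax / 2 * (L * e)\<^sup>2"
    using ax by (intro mult_left_mono) auto
  let ?d = "prox_lip * (ax * norm dx)"
  have "norm ey = 1 / \<gamma> * norm (\<theta> - prox_argmin g \<gamma> (x', y))"
    unfolding ey_def dy by (rule y_dir_error)
  also have "\<dots> \<le> 1 / \<gamma> * (e + ?d)"
    using \<gamma>_pos by (intro mult_left_mono half_step_prox_drift) auto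
  finally have "(norm ey)\<^sup>2 \<le> (1 / \<gamma> * (e + ?d))\<^sup>2"
    by (intro power_mono norm_ge_zero)
  also have "\<dots> = 1 / \<gamma>\<^sup>2 * (e + ?d)\<^sup>2"
    by (simp add: power_mult_distrib power_divide)
  also have "\<dots> \<le> 1 / \<gamma>\<^sup>2 * (2 * e\<^sup>2 + 2 * ?d\<^sup>2)"
    using power2_norm_add_le[of 1 e ?d] by (intro mult_left_mono) auto
  finally have "ay / 2 * (norm ey)\<^sup>2 \<le> ay / 2 * (1 / \<gamma>\<^sup>2 * (2 * e\<^sup>2 + 2 * ?d\<^sup>2))"
    using ay by (intro mult_left_mono) auto
  also have "\<dots> = ay / \<gamma>\<^sup>2 * e\<^sup>2 + ay / \<gamma>\<^sup>2 * ?d\<^sup>2"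
    by (simp add: distrib_left add_divide_distrib)
  finally have "merit c (x', y') \<le> merit c (x, y) - ax / 4 * (norm dx)\<^sup>2 - ay / 4 * (norm dy)\<^sup>2
      + ax / 2 * (L * e)\<^sup>2 + (ay / \<gamma>\<^sup>2 * e\<^sup>2 + ay / \<gamma>\<^sup>2 * ?d\<^sup>2)"
    using X Y ex by linarith
  then show ?thesis by (simp add: algebra_simps power_mult_distrib)
qed

text \<open>Each direction approximates its block of the gradient at the point where it was
  evaluated; Lipschitz continuity carries these blocks to the new iterate.\<close>

lemma merit_grad_bound:
  assumes "ax \<le> 1" "ay \<le> 1"
  shows "norm (merit_grad c (x', y'))
    \<le> (1 + 2 * merit_lip + L + 1 / \<gamma> + prox_lip / \<gamma>) * (norm dx + norm dy + e)"
proof -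
  have adx: "ax * norm dx \<le> norm dx" and ady: "ay * norm dy \<le> norm dy"
    using assms by (simp_all add: mult_left_le_one_le ax ay)
  have e: "0 \<le> e" by (simp add: e_def)
  have shift: "norm (merit_grad c p - merit_grad c q) \<le> merit_lip * r" if "norm (p - q) \<le> r" for p q r
    using merit_grad_lipschitz[OF c, of p q] mult_left_mono[OF that merit_lip_nonneg] by linarith
  have "norm ((x', y') - (x, y)) \<le> norm dx + norm dy"
    using norm_Pair_le[of "x' - x" "y' - y"] ax ay adx ady by (simp add: x' y')
  then have "norm (fst (merit_grad c (x', y') - merit_grad c (x, y))) \<le> merit_lip * (norm dx + norm dy)"
    by (intro order_trans[OF norm_fst_pair_le shift])
  moreover have "norm (dx - fst (merit_grad c (x, y))) \<le> L * e"
    unfolding dx e_def by (rule x_dir_error)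
  ultimately have "norm (fst (merit_grad c (x', y'))) \<le> norm dx + L * e + merit_lip * (norm dx + norm dy)"
    using norm_triangle_ineq[of "fst (merit_grad c (x', y') - merit_grad c (x, y))" "fst (merit_grad c (x, y))"]
      norm_triangle_ineq4[of dx "dx - fst (merit_grad c (x, y))"]
    by simp
  moreover have "norm (snd (merit_grad c (x', y')))
      \<le> norm dy + 1 / \<gamma> * (e + prox_lip * norm dx) + merit_lip * norm dy"
  proof -
    have "norm ((x', y') - (x', y)) \<le> norm dy"
      using ay ady by (simp add: y' norm_Pair)
    then have "norm (snd (merit_grad c (x', y') - merit_grad c (x', y))) \<le> merit_lip * norm dy"
      by (intro order_trans[OF norm_snd_pair_le shift])
    moreover have "norm (dy - snd (merit_grad c (x', y))) \<le> 1 / \<gamma> * (e + prox_lip * norm dx)"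
      unfolding dy y_dir_error
      using half_step_prox_drift mult_left_mono[OF adx prox_lip_nonneg] \<gamma>_pos
      by (intro mult_left_mono) auto
    ultimately show ?thesis
      using norm_triangle_ineq[of "snd (merit_grad c (x', y') - merit_grad c (x', y))" "snd (merit_grad c (x', y))"]
        norm_triangle_ineq4[of dy "dy - snd (merit_grad c (x', y))"]
      by simp
  qed
  ultimately have "norm (merit_grad c (x', y')) \<le> norm dx + L * e + merit_lip * (norm dx + norm dy)
      + (norm dy + 1 / \<gamma> * (e + prox_lip * norm dx) + merit_lip * norm dy)"
    using norm_Pair_le[of "fst (merit_grad c (x', y'))" "snd (merit_grad c (x', y'))"] by simp
  also have "\<dots> \<le> (1 + 2 * merit_lip + L + 1 / \<gamma> + prox_lip / \<gamma>) * (norm dx + norm dy + e)"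
  proof -
    define n1 n2 where "n1 = norm dx" and "n2 = norm dy"
    define i k where "i = 1 / \<gamma>" and "k = prox_lip / \<gamma>"
    have "0 \<le> n1" "0 \<le> n2" "0 \<le> i" "0 \<le> k"
      using \<gamma>_pos prox_lip_nonneg by (simp_all add: n1_def n2_def i_def k_def)
    \<comment> \<open>The difference of the two sides of the next inequality, expanded into
      nonnegative products.\<close>
    then have "0 \<le> e + (merit_lip * n1 + 2 * merit_lip * e) + (L * n1 + L * n2) + (i * n1 + i * n2) + (k * n2 + k * e)"
      using e merit_lip_nonneg L_nonneg by simp
    then have "n1 + L * e + merit_lip * (n1 + n2) + (n2 + (i * e + k * n1) + merit_lip * n2)
        \<le> (1 + 2 * merit_lip + L + i + k) * (n1 + n2 + e)"
      by (simp add: algebra_simps)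
    then show ?thesis by (simp add: n1_def n2_def i_def k_def algebra_simps)
  qed
  finally show ?thesis .
qed

text \<open>The factor \<open>1 + \<delta>\<close> must not undo the contraction of the inner step;
  \<open>lyapunov_descent\<close> takes \<open>\<delta> = \<sigma> / 2\<close>.\<close>

lemma prox_error_step:
  assumes "0 < \<delta>"
  shows "(norm (\<theta> - prox_argmin g \<gamma> (x', y')))\<^sup>2
    \<le> (1 + \<delta>) * e\<^sup>2 + (1 + 1 / \<delta>) * (prox_lip\<^sup>2 * ((ax * norm dx)\<^sup>2 + (ay * norm dy)\<^sup>2))"
proof -
  let ?v = "prox_argmin g \<gamma> (x, y)" and ?v' = "prox_argmin g \<gamma> (x', y')"
  have "(norm (?v - ?v'))\<^sup>2 \<le> (prox_lip * norm ((x, y) - (x', y')))\<^sup>2"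
    by (intro power_mono prox_argmin_lipschitz norm_ge_zero)
  also have "\<dots> = prox_lip\<^sup>2 * ((ax * norm dx)\<^sup>2 + (ay * norm dy)\<^sup>2)"
    by (simp add: power_mult_distrib norm_Pair x' y')
  finally have "(1 + 1 / \<delta>) * (norm (?v - ?v'))\<^sup>2
      \<le> (1 + 1 / \<delta>) * (prox_lip\<^sup>2 * ((ax * norm dx)\<^sup>2 + (ay * norm dy)\<^sup>2))"
    using assms by (intro mult_left_mono) auto
  with power2_norm_add_le[OF assms, of "\<theta> - ?v" "?v - ?v'"] show ?thesis
    by (simp add: e_def)
qed

end

end

subsection \<open>The Lyapunov function\<close>

lemma power2_sum3_le: "(a + b + c :: real)\<^sup>2 \<le> 3 * (a\<^sup>2 + b\<^sup>2 + c\<^sup>2)"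
proof -
  have "0 \<le> (a - b)\<^sup>2 + (b - c)\<^sup>2 + (a - c)\<^sup>2" by simp
  then show ?thesis by (simp add: power2_eq_square algebra_simps)
qed

section \<open>Admissible step sizes\<close>

context penalized_lower
begin

text \<open>The budget of \<open>lyapunov_descent\<close>. The bound with \<open>merit_lip\<close>
  permits the block steps, the one with \<open>\<sigma> / 4\<close> absorbs the inner error, and
  each bound \<open>1 / 16\<close> charges a drift of the minimizer against the descent coefficient
  \<open>1 / 4\<close>, leaving \<open>1 / 8\<close>.\<close>

definition admissible_step :: "real \<Rightarrow> real \<Rightarrow> bool" where
  "admissible_step \<sigma> A \<longleftrightarrow> 0 < A \<and> A \<le> 1 \<and> A * merit_lip \<le> 1 / 2 \<and>
     A * (L\<^sup>2 / 2 + 1 / \<gamma>\<^sup>2) \<le> \<sigma> / 4 \<and> A * (prox_lip\<^sup>2 / \<gamma>\<^sup>2) \<le> 1 / 16 \<and>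
     A * ((1 + 2 / \<sigma>) * prox_lip\<^sup>2) \<le> 1 / 16"

lemma admissible_step_exists:
  assumes "0 < \<sigma>"
  shows "\<exists>A. admissible_step \<sigma> A"
proof -
  \<comment> \<open>Each of these is scaled so that \<open>A * X \<le> 1\<close> is one of the
    conditions; the reciprocal of one plus their sum meets all of them.\<close>
  define X1 X2 X3 X4 where "X1 = 2 * merit_lip" and "X2 = 4 / \<sigma> * (L\<^sup>2 / 2 + 1 / \<gamma>\<^sup>2)"
    and "X3 = 16 * (prox_lip\<^sup>2 / \<gamma>\<^sup>2)" and "X4 = 16 * ((1 + 2 / \<sigma>) * prox_lip\<^sup>2)"
  define A where "A = 1 / (1 + X1 + X2 + X3 + X4)"
  have X: "0 \<le> X1" "0 \<le> X2" "0 \<le> X3" "0 \<le> X4"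
    using assms merit_lip_nonneg by (auto simp: X1_def X2_def X3_def X4_def)
  then have "0 < A" by (simp add: A_def)
  have le: "A * X \<le> 1" if "X \<le> 1 + X1 + X2 + X3 + X4" for X
    using that X by (simp add: A_def)
  have "A * X2 \<le> 1" "A * 1 \<le> 1" "A * X1 \<le> 1" "A * X3 \<le> 1" "A * X4 \<le> 1"
    by (rule le, use X in linarith)+
  moreover have "A * (L\<^sup>2 / 2 + 1 / \<gamma>\<^sup>2) = \<sigma> / 4 * (A * X2)"
    using assms by (simp add: X2_def)
  then have "A * (L\<^sup>2 / 2 + 1 / \<gamma>\<^sup>2) \<le> \<sigma> / 4 * 1"
    using assms \<open>A * X2 \<le> 1\<close> by (simp only:) (intro mult_left_mono, auto)
  moreover have "A * X1 = 2 * (A * merit_lip)" "A * X3 = 16 * (A * (prox_lip\<^sup>2 / \<gamma>\<^sup>2))"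
    "A * X4 = 16 * (A * ((1 + 2 / \<sigma>) * prox_lip\<^sup>2))"
    by (simp_all add: X1_def X3_def X4_def)
  ultimately have "admissible_step \<sigma> A"
    using \<open>0 < A\<close> unfolding admissible_step_def by (intro conjI; linarith)
  then show ?thesis ..
qed

section \<open>Lyapunov descent in one iteration\<close>

context
  fixes c ax ay A \<sigma> r :: real and x x' :: 'a and y y' \<theta> :: 'b and dx dy
  assumes c: "c0 \<le> c"
    and dx: "dx = x_dir c x y \<theta>" and x': "x' = x - ax *\<^sub>R dx"
    and dy: "dy = y_dir c x' y \<theta>" and y': "y' = y - ay *\<^sub>R dy"
    and ax: "0 \<le> ax" "ax \<le> A" and ay: "0 \<le> ay" "ay \<le> A"
    and \<sigma>: "0 < \<sigma>" "\<sigma> \<le> 1" and A: "admissible_step \<sigma> A"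
    and r: "(norm (\<theta> - prox_argmin g \<gamma> (x, y)))\<^sup>2 \<le> (1 - \<sigma>) * r" "0 \<le> r"
begin

lemma admissible_step_le:
  assumes "0 \<le> a" "a \<le> A"
  shows "a \<le> 1" "a * merit_lip \<le> 1 / 2" "a * (prox_lip\<^sup>2 / \<gamma>\<^sup>2) \<le> 1 / 16"
    "a * ((1 + 2 / \<sigma>) * prox_lip\<^sup>2) \<le> 1 / 16"
proof -
  have le: "a * X \<le> B" if "A * X \<le> B" "0 \<le> X" for X B
    using mult_right_mono[OF assms(2) that(2)] that(1) by linarith
  have AA: "A \<le> 1" "A * merit_lip \<le> 1 / 2" "A * (prox_lip\<^sup>2 / \<gamma>\<^sup>2) \<le> 1 / 16"
    "A * ((1 + 2 / \<sigma>) * prox_lip\<^sup>2) \<le> 1 / 16"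
    using A unfolding admissible_step_def by blast+
  show "a \<le> 1" using assms(2) AA(1) by linarith
  show "a * merit_lip \<le> 1 / 2" by (rule le[OF AA(2) merit_lip_nonneg])
  show "a * (prox_lip\<^sup>2 / \<gamma>\<^sup>2) \<le> 1 / 16" by (rule le[OF AA(3)]) simp
  show "a * ((1 + 2 / \<sigma>) * prox_lip\<^sup>2) \<le> 1 / 16" by (rule le[OF AA(4)]) (use \<sigma> in simp)
qed

text \<open>\<open>r\<close> stands for the squared distance to the minimizer before the inner
  gradient step, which leaves at most \<open>(1 - \<sigma>) * r\<close>. Regrowth by the factor
  \<open>1 + \<sigma> / 2\<close> still loses \<open>\<sigma> / 2 * r\<close>, and half of this pays
  for the inexact directions.\<close>

lemma lyapunov_descent:
  "merit c (x', y') + (norm (\<theta> - prox_argmin g \<gamma> (x', y')))\<^sup>2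
     \<le> merit c (x, y) + r - ax / 8 * (norm dx)\<^sup>2 - ay / 8 * (norm dy)\<^sup>2 - \<sigma> / 4 * r"
proof -
  note xstep = admissible_step_le[OF ax] and ystep = admissible_step_le[OF ay]
  define e where "e = norm (\<theta> - prox_argmin g \<gamma> (x, y))"
  define X Y where "X = (norm dx)\<^sup>2" and "Y = (norm dy)\<^sup>2"
  have XY: "0 \<le> X" "0 \<le> Y" by (simp_all add: X_def Y_def)
  have e_le: "e\<^sup>2 \<le> (1 - \<sigma>) * r" using r by (simp add: e_def)
  also have "\<dots> \<le> r" using \<sigma> r by (simp add: mult_left_le_one_le)
  finally have "e\<^sup>2 \<le> r" .
  have "ax * L\<^sup>2 / 2 + ay / \<gamma>\<^sup>2 = ax * (L\<^sup>2 / 2) + ay * (1 / \<gamma>\<^sup>2)" by simp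
  also have "\<dots> \<le> A * (L\<^sup>2 / 2) + A * (1 / \<gamma>\<^sup>2)"
    using ax ay by (intro add_mono mult_right_mono) auto
  also have "\<dots> \<le> \<sigma> / 4"
    using A by (simp add: admissible_step_def distrib_left)
  finally have t1: "(ax * L\<^sup>2 / 2 + ay / \<gamma>\<^sup>2) * e\<^sup>2 \<le> \<sigma> / 4 * r"
    using \<open>e\<^sup>2 \<le> r\<close> \<sigma> by (intro mult_mono) auto
  have "ay / \<gamma>\<^sup>2 * (prox_lip * (ax * norm dx))\<^sup>2 = ay * (prox_lip\<^sup>2 / \<gamma>\<^sup>2) * (ax * (ax * X))"
    by (simp add: X_def power2_eq_square)
  also have "\<dots> \<le> 1 / 16 * (1 * (ax * X))"
    using ystep xstep ax ay XY by (intro mult_mono) auto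
  finally have t2: "ay / \<gamma>\<^sup>2 * (prox_lip * (ax * norm dx))\<^sup>2 \<le> ax / 16 * X" by simp
  have "(1 + 2 / \<sigma>) * (prox_lip\<^sup>2 * ((ax * norm dx)\<^sup>2 + (ay * norm dy)\<^sup>2))
      = ax * ((1 + 2 / \<sigma>) * prox_lip\<^sup>2) * (ax * X) + ay * ((1 + 2 / \<sigma>) * prox_lip\<^sup>2) * (ay * Y)"
    unfolding X_def Y_def power_mult_distrib power2_eq_square[of ax] power2_eq_square[of ay] by algebra
  also have "\<dots> \<le> 1 / 16 * (ax * X) + 1 / 16 * (ay * Y)"
    using ystep xstep ax ay XY by (intro add_mono mult_right_mono) auto
  finally have t3: "(1 + 2 / \<sigma>) * (prox_lip\<^sup>2 * ((ax * norm dx)\<^sup>2 + (ay * norm dy)\<^sup>2))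
      \<le> ax / 16 * X + ay / 16 * Y" by simp
  have "(1 + \<sigma> / 2) * e\<^sup>2 \<le> (1 + \<sigma> / 2) * ((1 - \<sigma>) * r)"
    using e_le \<sigma> by (intro mult_left_mono) auto
  also have "\<dots> = r - \<sigma> / 2 * r - \<sigma>\<^sup>2 / 2 * r" by (simp add: power2_eq_square field_simps)
  also have "\<dots> \<le> r - \<sigma> / 2 * r" using r(2) by simp
  finally have t4: "(1 + \<sigma> / 2) * e\<^sup>2 \<le> r - \<sigma> / 2 * r" .
  have "merit c (x', y') \<le> merit c (x, y) - ax / 4 * X - ay / 4 * Y
      + (ax * L\<^sup>2 / 2 + ay / \<gamma>\<^sup>2) * e\<^sup>2 + ay / \<gamma>\<^sup>2 * (prox_lip * (ax * norm dx))\<^sup>2"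
    unfolding X_def Y_def e_def by (rule merit_descent[OF c dx x' dy y' ax(1) xstep(2) ay(1) ystep(2)])
  moreover have "(norm (\<theta> - prox_argmin g \<gamma> (x', y')))\<^sup>2
      \<le> (1 + \<sigma> / 2) * e\<^sup>2 + (1 + 2 / \<sigma>) * (prox_lip\<^sup>2 * ((ax * norm dx)\<^sup>2 + (ay * norm dy)\<^sup>2))"
    using prox_error_step[OF c dx x' dy y' ax(1) xstep(2) ay(1) ystep(2), of "\<sigma> / 2"] \<sigma>
    by (simp add: e_def)
  moreover have "0 \<le> ay / 16 * Y" using ay XY by simp
  ultimately show ?thesis
    using t1 t2 t3 t4 unfolding X_def Y_def by linarith
qed

text \<open>The right-hand side consists of the quantities that \<open>lyapunov_descent\<close>
  subtracts, which is what makes the squared gradients summable.\<close>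

lemma merit_grad_sq_bound:
  "(norm (merit_grad c (x', y')))\<^sup>2 \<le> 3 * (1 + 2 * merit_lip + L + 1 / \<gamma> + prox_lip / \<gamma>)\<^sup>2
     * ((norm dx)\<^sup>2 + (norm dy)\<^sup>2 + r)"
proof -
  note xstep = admissible_step_le[OF ax] and ystep = admissible_step_le[OF ay]
  define e where "e = norm (\<theta> - prox_argmin g \<gamma> (x, y))"
  define B where "B = 1 + 2 * merit_lip + L + 1 / \<gamma> + prox_lip / \<gamma>"
  have "e\<^sup>2 \<le> (1 - \<sigma>) * r" using r by (simp add: e_def)
  also have "\<dots> \<le> r" using \<sigma> r by (simp add: mult_left_le_one_le)
  finally have er: "e\<^sup>2 \<le> r" .
  have "norm (merit_grad c (x', y')) \<le> B * (norm dx + norm dy + e)"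
    unfolding B_def e_def
    by (rule merit_grad_bound[OF c dx x' dy y' ax(1) xstep(2) ay(1) ystep(2) xstep(1) ystep(1)])
  then have "(norm (merit_grad c (x', y')))\<^sup>2 \<le> (B * (norm dx + norm dy + e))\<^sup>2"
    by (intro power_mono norm_ge_zero)
  also have "\<dots> = B\<^sup>2 * (norm dx + norm dy + e)\<^sup>2" by (rule power_mult_distrib)
  also have "\<dots> \<le> B\<^sup>2 * (3 * ((norm dx)\<^sup>2 + (norm dy)\<^sup>2 + e\<^sup>2))"
    by (intro mult_left_mono power2_sum3_le) simp
  also have "\<dots> \<le> B\<^sup>2 * (3 * ((norm dx)\<^sup>2 + (norm dy)\<^sup>2 + r))"
    using er by (intro mult_left_mono) auto
  also have "\<dots> = 3 * B\<^sup>2 * ((norm dx)\<^sup>2 + (norm dy)\<^sup>2 + r)" by simp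
  finally show ?thesis unfolding B_def .
qed

end

section \<open>Summation over the iterations\<close>

lemma prox_rate:
  assumes "0 < a" "a \<le> \<alpha>" "\<alpha> * (L - \<rho> + 2 / \<gamma>) \<le> 2"
  shows "a * modulus \<le> 1"
    and "(norm (\<theta> - \<alpha> *\<^sub>R prox_grad p \<theta> - prox_argmin g \<gamma> p))\<^sup>2
      \<le> (1 - a * modulus) * (norm (\<theta> - prox_argmin g \<gamma> p))\<^sup>2"
proof -
  \<comment> \<open>This forces \<open>\<alpha> * modulus \<le> 1\<close>. The squared contraction
    factor is then at most the factor itself, and so at most the uniform
    \<open>1 - a * modulus\<close>.\<close>
  have "2 * modulus \<le> L - \<rho> + 2 / \<gamma>"
    using L_nonneg \<rho>_pos by (simp add: modulus_def)
  then have "\<alpha> * (2 * modulus) \<le> \<alpha> * (L - \<rho> + 2 / \<gamma>)"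
    using assms by (intro mult_left_mono) auto
  with assms(3) have \<alpha>: "\<alpha> * modulus \<le> 1" by linarith
  have le: "a * modulus \<le> \<alpha> * modulus"
    using assms modulus_pos by (intro mult_right_mono) auto
  with \<alpha> show "a * modulus \<le> 1" by linarith
  have "0 \<le> \<alpha> * modulus" using assms modulus_pos by simp
  have "(1 - \<alpha> * modulus)\<^sup>2 \<le> 1 - \<alpha> * modulus"
    unfolding power2_eq_square by (rule mult_left_le) (use \<alpha> \<open>0 \<le> \<alpha> * modulus\<close> in auto)
  with le have "(1 - \<alpha> * modulus)\<^sup>2 \<le> 1 - a * modulus" by linarith
  with prox_step_contraction[of \<alpha> \<theta> p] assms
  show "(norm (\<theta> - \<alpha> *\<^sub>R prox_grad p \<theta> - prox_argmin g \<gamma> p))\<^sup>2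
      \<le> (1 - a * modulus) * (norm (\<theta> - prox_argmin g \<gamma> p))\<^sup>2"
    by (meson mult_right_mono order_trans zero_le_power2 less_imp_le less_le_trans)
qed

text \<open>The decrease of \<open>V\<close> telescopes and \<open>V\<close> is nonnegative because
  the gap is; hence the squared gradients are summable and the gap stays below \<open>V 0\<close>.
  Allowing any nondecreasing penalty from \<open>c0\<close> upwards covers both schedules.\<close>

lemma momeha_bounds:
  assumes alg: "momeha F g \<gamma> x0 y0 a\<theta> ax ay c x y \<theta>"
    and c: "\<And>t. c0 \<le> c t" "\<And>t. c t \<le> c (Suc t)"
    and a\<theta>: "0 < a" "\<And>t. a \<le> a\<theta> t" "\<And>t. a\<theta> t * (L - \<rho> + 2 / \<gamma>) \<le> 2"
    and A: "admissible_step (a * modulus) A"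
    and ax: "0 < ax_lo" "\<And>t. ax t \<in> {ax_lo..A}"
    and ay: "0 < ay_lo" "\<And>t. ay t \<in> {ay_lo..A}"
  obtains C V where "\<And>T. (\<Sum>t<T. (norm (merit_grad (c t) (x (Suc t), y (Suc t))))\<^sup>2) \<le> C"
    and "\<And>t. gap g \<gamma> (x t, y t) \<le> V"
proof -
  define \<sigma> where "\<sigma> = a * modulus"
  have \<sigma>: "0 < \<sigma>" "\<sigma> \<le> 1"
    using a\<theta> modulus_pos prox_rate(1)[OF a\<theta>(1) a\<theta>(2) a\<theta>(3)] by (simp_all add: \<sigma>_def)
  define r where "r t = (norm (\<theta> t - prox_argmin g \<gamma> (x t, y t)))\<^sup>2" for t
  define dx where "dx t = x_dir (c t) (x t) (y t) (\<theta> (Suc t))" for t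
  define dy where "dy t = y_dir (c t) (x (Suc t)) (y t) (\<theta> (Suc t))" for t
  define V where "V t = merit (c t) (x t, y t) + r t" for t
  define n where "n t = (norm (merit_grad (c t) (x (Suc t), y (Suc t))))\<^sup>2" for t
  \<comment> \<open>A common lower bound for the three coefficients in
    \<open>lyapunov_descent\<close>, positive because the step sizes are bounded below.\<close>
  define \<kappa> where "\<kappa> = min (ax_lo / 8) (min (ay_lo / 8) (\<sigma> / 4))"
  define B where "B = 3 * (1 + 2 * merit_lip + L + 1 / \<gamma> + prox_lip / \<gamma>)\<^sup>2"
  have cpos: "0 < c t" for t using c(1)[of t] c0_pos by linarith
  have \<theta>': "\<theta> (Suc t) = \<theta> t - a\<theta> t *\<^sub>R prox_grad (x t, y t) (\<theta> t)" for t
    using alg by (simp add: momeha_def prox_grad_def grad_y_eq[OF g_deriv])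
  have x': "x (Suc t) = x t - ax t *\<^sub>R dx t" for t
    using alg by (simp add: momeha_def dx_def x_dir_def)
  have y': "y (Suc t) = y t - ay t *\<^sub>R dy t" for t
    using alg by (simp add: momeha_def dy_def y_dir_def)
  have axt: "0 \<le> ax t" "ax t \<le> A" and ayt: "0 \<le> ay t" "ay t \<le> A" for t
    using ax(1) ax(2)[of t] ay(1) ay(2)[of t] by auto
  have rt: "0 \<le> r t" for t by (simp add: r_def)
  have rate: "(norm (\<theta> (Suc t) - prox_argmin g \<gamma> (x t, y t)))\<^sup>2 \<le> (1 - \<sigma>) * r t" for t
    unfolding \<theta>' r_def \<sigma>_def by (rule prox_rate(2)[OF a\<theta>])
  note step = c(1) dx_def x' dy_def y' axt ayt \<sigma> A[folded \<sigma>_def] rate rt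
  have V_nonneg: "0 \<le> V t" for t
    using gap_nonneg[of "(x t, y t)"] gap_le_merit[OF cpos[of t], of "(x t, y t)"] rt[of t]
    by (simp add: V_def)
  have \<kappa>: "0 < \<kappa>" using ax ay \<sigma> by (simp add: \<kappa>_def)
  have descent: "V (Suc t) \<le> V t - \<kappa> * ((norm (dx t))\<^sup>2 + (norm (dy t))\<^sup>2 + r t)" for t
  proof -
    have le: "\<kappa> \<le> ax t / 8" "\<kappa> \<le> ay t / 8" "\<kappa> \<le> \<sigma> / 4"
      using ax(2)[of t] ay(2)[of t] by (auto simp: \<kappa>_def)
    have "\<kappa> * (norm (dx t))\<^sup>2 \<le> ax t / 8 * (norm (dx t))\<^sup>2" "\<kappa> * (norm (dy t))\<^sup>2 \<le> ay t / 8 * (norm (dy t))\<^sup>2"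
      "\<kappa> * r t \<le> \<sigma> / 4 * r t"
      by (intro mult_right_mono le zero_le_power2 rt)+
    \<comment> \<open>Passing to the next penalty does not increase the merit.\<close>
    moreover have "merit (c (Suc t)) (x (Suc t), y (Suc t)) \<le> merit (c t) (x (Suc t), y (Suc t))"
      by (intro merit_antimono cpos c)
    ultimately show ?thesis
      using lyapunov_descent[OF step, of t] unfolding V_def r_def[of "Suc t"] distrib_left by linarith
  qed
  have "\<kappa> * n t \<le> B * (V t - V (Suc t))" for t
  proof -
    have "\<kappa> * n t \<le> \<kappa> * (B * ((norm (dx t))\<^sup>2 + (norm (dy t))\<^sup>2 + r t))"
      unfolding n_def B_def using \<kappa> by (intro mult_left_mono merit_grad_sq_bound[OF step]) auto
    also have "\<dots> = B * (\<kappa> * ((norm (dx t))\<^sup>2 + (norm (dy t))\<^sup>2 + r t))" by simp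
    also have "\<dots> \<le> B * (V t - V (Suc t))"
      using descent[of t] by (intro mult_left_mono) (auto simp: B_def)
    finally show ?thesis .
  qed
  then have "(\<Sum>t<T. \<kappa> * n t) \<le> (\<Sum>t<T. B * (V t - V (Suc t)))" for T
    by (intro sum_mono)
  then have "\<kappa> * (\<Sum>t<T. n t) \<le> B * (V 0 - V T)" for T
    by (simp only: sum_distrib_left[symmetric] sum_lessThan_telescope')
  moreover have "B * (V 0 - V T) \<le> B * V 0" for T
    using V_nonneg[of T] by (intro mult_left_mono) (auto simp: B_def)
  ultimately have "\<kappa> * (\<Sum>t<T. n t) \<le> B * V 0" for T
    using order_trans by blast
  then have "(\<Sum>t<T. n t) \<le> B * V 0 / \<kappa>" for T
    using \<kappa> by (simp add: pos_le_divide_eq mult.commute)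
  moreover have "gap g \<gamma> (x t, y t) \<le> V 0" for t
  proof -
    have "decseq V"
    proof (rule decseq_SucI)
      fix t
      have "0 \<le> \<kappa> * ((norm (dx t))\<^sup>2 + (norm (dy t))\<^sup>2 + r t)"
        using \<kappa> rt by (intro mult_nonneg_nonneg add_nonneg_nonneg) auto
      with descent[of t] show "V (Suc t) \<le> V t" by linarith
    qed
    then have "V t \<le> V 0" by (auto dest: decseqD)
    then show ?thesis
      using gap_le_merit[OF cpos[of t], of "(x t, y t)"] rt[of t] by (simp add: V_def)
  qed
  ultimately show thesis unfolding n_def by (rule that)
qed

end

subsection \<open>Scalarization and rates\<close>

text \<open>The coefficients are the softmax weights \<open>E i / sum E UNIV\<close> times
  \<open>w $ i\<close>; the factor \<open>\<mu>\<close> of the inner derivatives cancels the outer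
  \<open>1 / \<mu>\<close>.\<close>

lemma GDERIV_stch:
  fixes f :: "'m::finite \<Rightarrow> 'a::euclidean_space \<Rightarrow> real" and w z :: "real ^ 'm"
  assumes "0 < \<mu>" and deriv: "\<And>i. GDERIV (f i) p :> G i"
  defines "E \<equiv> \<lambda>i. exp (\<mu> * w $ i * (f i p - z $ i))"
  shows "GDERIV (stch w z \<mu> f) p :> (\<Sum>i\<in>UNIV. (E i / sum E UNIV * w $ i) *\<^sub>R G i)"
proof -
  have pos: "0 < sum E UNIV" by (simp add: E_def sum_pos)
  have E': "((\<lambda>q. exp (\<mu> * w $ i * (f i q - z $ i))) has_derivative (\<lambda>k. E i * (\<mu> * w $ i * (k \<bullet> G i)))) (at p)" for i
    using deriv[of i] unfolding gderiv_def E_def by (auto intro!: derivative_eq_intros)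
  have "((\<lambda>q. \<Sum>i\<in>UNIV. exp (\<mu> * w $ i * (f i q - z $ i)))
      has_derivative (\<lambda>k. \<Sum>i\<in>UNIV. E i * (\<mu> * w $ i * (k \<bullet> G i)))) (at p)"
    by (rule has_derivative_sum) (rule E')
  from has_derivative_ln[OF _ this] pos
  have "((\<lambda>q. ln (\<Sum>i\<in>UNIV. exp (\<mu> * w $ i * (f i q - z $ i))))
      has_derivative (\<lambda>k. (\<Sum>i\<in>UNIV. E i * (\<mu> * w $ i * (k \<bullet> G i))) * inverse (sum E UNIV))) (at p)"
    by (simp add: E_def)
  from has_derivative_mult_right[OF this, of "1 / \<mu>"]
  show ?thesis
    unfolding gderiv_def stch_def[abs_def]
  proof (rule has_derivative_eq_rhs)
    show "(\<lambda>k. 1 / \<mu> * ((\<Sum>i\<in>UNIV. E i * (\<mu> * w $ i * (k \<bullet> G i))) * inverse (sum E UNIV)))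
        = (\<lambda>k. k \<bullet> (\<Sum>i\<in>UNIV. (E i / sum E UNIV * w $ i) *\<^sub>R G i))"
      unfolding inner_sum_right sum_distrib_left sum_distrib_right
      using \<open>0 < \<mu>\<close> pos by (intro ext sum.cong refl) (simp add: field_simps)
  qed
qed

lemma stationarity_measure_nonneg:
  fixes f :: "'m::finite \<Rightarrow> 'a::euclidean_space \<times> 'b::euclidean_space \<Rightarrow> real"
  shows "0 \<le> stationarity_measure f g \<gamma> p u"
  unfolding stationarity_measure_def
proof (rule cINF_greatest)
  show "(prob_simplex :: (real ^ 'm) set) \<noteq> {}"
  proof -
    have "axis undefined 1 \<in> (prob_simplex :: (real ^ 'm) set)"
      by (simp add: prob_simplex_def axis_def)
    then show ?thesis by blast
  qed
qed simp

text \<open>Dividing the gradient of the scalarization by the total weight \<open>S\<close> of its softmax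
  combination yields a point of the simplex, so the multiplier is \<open>c / S\<close>.\<close>

lemma stationarity_measure_le_stch:
  fixes f :: "'m::finite \<Rightarrow> 'a::euclidean_space \<times> 'b::euclidean_space \<Rightarrow> real" and w z :: "real ^ 'm"
  assumes "0 < \<mu>" and f: "\<And>i. f i differentiable (at u)"
    and \<omega>: "0 < \<omega>" "\<And>i. \<omega> \<le> w $ i" and "0 \<le> c"
  shows "\<exists>p\<ge>0. stationarity_measure f g \<gamma> p u
    \<le> norm (grad (stch w z \<mu> f) u + c *\<^sub>R (grad g u - grad (moreau_value g \<gamma>) u)) / \<omega>"
proof -
  define E where "E i = exp (\<mu> * w $ i * (f i u - z $ i))" for i
  define a where "a i = E i / sum E UNIV * w $ i" for i
  define S where "S = sum a UNIV"
  define d where "d = grad g u - grad (moreau_value g \<gamma>) u"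
  have E: "0 < sum E UNIV" "0 \<le> E i" for i by (simp_all add: E_def sum_pos)
  \<comment> \<open>The softmax weights sum to one, so \<open>S\<close> is a weighted average of the
    entries of \<open>w\<close>.\<close>
  have "\<omega> = (\<Sum>i\<in>UNIV. E i / sum E UNIV * \<omega>)"
    using E by (simp add: sum_distrib_right[symmetric] sum_divide_distrib[symmetric])
  also have "\<dots> \<le> S"
    unfolding S_def a_def using E \<omega> by (intro sum_mono mult_left_mono) auto
  finally have S: "\<omega> \<le> S" "0 < S" using \<omega> by auto
  have a: "0 \<le> a i" for i
    using E \<omega>(1) \<omega>(2)[of i] by (simp add: a_def)
  define l where "l = (\<chi> i. a i / S)"
  have l: "l \<in> prob_simplex"
    using a S by (simp add: prob_simplex_def l_def sum_divide_distrib[symmetric] S_def[symmetric])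
  have gradF: "grad (stch w z \<mu> f) u = (\<Sum>i\<in>UNIV. a i *\<^sub>R grad (f i) u)"
    unfolding a_def E_def using assms(1) f by (intro grad_eqI GDERIV_stch GDERIV_grad)
  have "stationarity_measure f g \<gamma> (c / S) u
      \<le> norm ((\<Sum>i\<in>UNIV. l $ i *\<^sub>R grad (f i) u) + (c / S) *\<^sub>R d)"
    unfolding stationarity_measure_def d_def by (rule cINF_lower[OF bdd_belowI2[of _ 0] l]) simp
  also have "(\<Sum>i\<in>UNIV. l $ i *\<^sub>R grad (f i) u) + (c / S) *\<^sub>R d
      = (1 / S) *\<^sub>R (grad (stch w z \<mu> f) u + c *\<^sub>R d)"
    by (simp add: gradF l_def scaleR_add_right scaleR_sum_right)
  also have "norm \<dots> \<le> norm (grad (stch w z \<mu> f) u + c *\<^sub>R d) / \<omega>"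
    using S \<omega> by (simp add: frac_le)
  finally show ?thesis
    using S \<open>0 \<le> c\<close> unfolding d_def by (intro exI[of _ "c / S"]) simp
qed

text \<open>Otherwise the indices in the upper half of \<open>{0..T}\<close> alone would contribute
  more than \<open>C\<close>. For such late indices a power of \<open>t\<close> is comparable to the
  same power of \<open>T\<close>.\<close>

lemma best_late_iterate:
  fixes n :: "nat \<Rightarrow> real"
  assumes "\<And>T. (\<Sum>t<T. (n t)\<^sup>2) \<le> C"
  shows "\<exists>t\<le>T. T \<le> 2 * t \<and> (n t)\<^sup>2 \<le> 2 * C / (1 + real T)"
proof (rule ccontr)
  assume no: "\<not> ?thesis"
  \<comment> \<open>The interval starts at \<open>T / 2\<close> rounded up, so it holds at least
    half of the \<open>1 + T\<close> indices.\<close>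
  let ?I = "{(T + 1) div 2..T}"
  have card: "1 + real T \<le> 2 * real (card ?I)" by auto
  have "0 \<le> C" using assms[of 0] by simp
  have "C \<le> real (card ?I) * (2 * C / (1 + real T))"
    using mult_right_mono[OF card \<open>0 \<le> C\<close>] by (simp add: field_simps)
  also have "\<dots> = (\<Sum>t\<in>?I. 2 * C / (1 + real T))" by simp
  also have "\<dots> < (\<Sum>t\<in>?I. (n t)\<^sup>2)"
  proof (rule sum_strict_mono)
    fix t assume "t \<in> ?I"
    then have "t \<le> T" "T \<le> 2 * t" by auto
    with no show "2 * C / (1 + real T) < (n t)\<^sup>2" by (meson not_le)
  qed auto
  also have "\<dots> \<le> (\<Sum>t<Suc T. (n t)\<^sup>2)" by (intro sum_mono2) auto
  also have "\<dots> \<le> C" by (rule assms)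
  finally show False by simp
qed

text \<open>Bounds in \<open>1 + real T\<close> stay meaningful at \<open>T = 0\<close>; since
  \<open>e \<le> 0\<close>, passing to \<open>real T\<close> only enlarges the power once
  \<open>T\<close> is positive.\<close>

lemma bigo_powrI:
  fixes X :: "nat \<Rightarrow> real"
  assumes "\<And>T. 0 \<le> X T" "\<And>T. X T \<le> K * (1 + real T) powr e" "e \<le> 0"
  shows "X \<in> O(\<lambda>T. real T powr e)"
proof (rule bigoI[of _ "\<bar>K\<bar>"])
  show "\<forall>\<^sub>F T in sequentially. norm (X T) \<le> \<bar>K\<bar> * norm (real T powr e)"
    using eventually_gt_at_top[of 0]
  proof eventually_elim
    case (elim T)
    have "K * (1 + real T) powr e \<le> \<bar>K\<bar> * real T powr e"
      using elim assms(3) by (intro mult_mono powr_mono2') auto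
    then show ?case using assms(1,2)[of T] by simp
  qed
qed

text \<open>The trade-off behind both regimes, with \<open>G\<close> the gap, \<open>s\<close> the
  residual and \<open>n\<close> the gradient norm: a penalty of order \<open>a\<close> gives the gap
  the order \<open>- a\<close> but multiplies the residual by order \<open>a\<close>, against the
  order \<open>- 1 / 2\<close> of the best gradient. The third claim needs both bounds at one
  index.\<close>

lemma best_iterate_rates:
  fixes G s n :: "nat \<Rightarrow> real"
  assumes G: "\<And>t. 0 \<le> G t" "\<And>t. G t \<le> M * (1 + real t) powr - a"
    and s: "\<And>t. 0 \<le> s t" "\<And>t. s t \<le> K * (1 + real t) powr a * n t"
    and n: "\<And>t. 0 \<le> n t" "\<And>T. (\<Sum>t<T. (n t)\<^sup>2) \<le> C"
    and a: "0 \<le> a" "a \<le> 1 / 2" and K: "0 \<le> K"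
  shows "G \<in> O(\<lambda>T. real T powr - a)"
    and "(\<lambda>T. MIN t\<in>{0..T}. s t) \<in> O(\<lambda>T. real T powr (a - 1 / 2))"
    and "\<exists>\<epsilon>c \<epsilon>s. \<epsilon>c \<in> O(\<lambda>T. real T powr - a) \<and> \<epsilon>s \<in> O(\<lambda>T. real T powr (a - 1 / 2)) \<and>
      (\<forall>T. \<exists>t\<le>T. G (Suc t) \<le> \<epsilon>c T \<and> s t \<le> \<epsilon>s T)"
proof -
  have M: "0 \<le> M" using order_trans[OF G(1) G(2)[of 0]] by simp
  have C: "0 \<le> C" using n(2)[of 0] by simp
  \<comment> \<open>The factor \<open>2 powr a\<close> pays for bounding
    \<open>1 + real (Suc t)\<close> below by \<open>(1 + real T) / 2\<close> at a late
    index.\<close>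
  define \<epsilon>c where "\<epsilon>c T = M * 2 powr a * (1 + real T) powr - a" for T :: nat
  define \<epsilon>s where "\<epsilon>s T = K * sqrt (2 * C) * (1 + real T) powr (a - 1 / 2)" for T :: nat
  have best: "\<exists>t\<le>T. G (Suc t) \<le> \<epsilon>c T \<and> s t \<le> \<epsilon>s T" for T
  proof -
    obtain t where t: "t \<le> T" "T \<le> 2 * t" "(n t)\<^sup>2 \<le> 2 * C / (1 + real T)"
      using best_late_iterate[of n C T] n(2) by blast
    have "G (Suc t) \<le> M * (1 + real (Suc t)) powr - a" by (rule G(2))
    also have "\<dots> \<le> M * ((1 + real T) / 2) powr - a"
      using M t a by (intro mult_left_mono powr_mono2') auto
    also have "\<dots> = \<epsilon>c T"
      by (simp add: \<epsilon>c_def powr_divide powr_minus field_simps)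
    finally have Gt: "G (Suc t) \<le> \<epsilon>c T" .
    have "n t \<le> sqrt (2 * C / (1 + real T))"
      using t(3) by (rule real_le_rsqrt)
    also have "\<dots> = sqrt (2 * C) * (1 + real T) powr (- 1 / 2)"
      using powr_minus_divide[of "1 + real T" "1 / 2"] by (simp add: real_sqrt_divide powr_half_sqrt)
    finally have nt: "n t \<le> sqrt (2 * C) * (1 + real T) powr (- 1 / 2)" .
    have "s t \<le> K * (1 + real t) powr a * n t" by (rule s(2))
    also have "\<dots> \<le> K * (1 + real T) powr a * (sqrt (2 * C) * (1 + real T) powr (- 1 / 2))"
      using nt K n(1) t a by (intro mult_mono powr_mono2) auto
    also have "\<dots> = K * sqrt (2 * C) * ((1 + real T) powr a * (1 + real T) powr (- 1 / 2))"
      by simp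
    also have "\<dots> = \<epsilon>s T" by (simp only: \<epsilon>s_def powr_add[symmetric]) simp
    finally show ?thesis using t(1) Gt by blast
  qed
  have "0 \<le> \<epsilon>c T" "0 \<le> \<epsilon>s T" for T using M K C by (simp_all add: \<epsilon>c_def \<epsilon>s_def)
  then have \<epsilon>: "\<epsilon>c \<in> O(\<lambda>T. real T powr - a)" "\<epsilon>s \<in> O(\<lambda>T. real T powr (a - 1 / 2))"
    using a by (auto intro!: bigo_powrI simp: \<epsilon>c_def \<epsilon>s_def)
  with best show "\<exists>\<epsilon>c \<epsilon>s. \<epsilon>c \<in> O(\<lambda>T. real T powr - a) \<and> \<epsilon>s \<in> O(\<lambda>T. real T powr (a - 1 / 2)) \<and>
      (\<forall>T. \<exists>t\<le>T. G (Suc t) \<le> \<epsilon>c T \<and> s t \<le> \<epsilon>s T)" by blast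
  show "G \<in> O(\<lambda>T. real T powr - a)" using G a by (intro bigo_powrI) auto
  show "(\<lambda>T. MIN t\<in>{0..T}. s t) \<in> O(\<lambda>T. real T powr (a - 1 / 2))"
  proof (rule bigo_powrI)
    show "0 \<le> (MIN t\<in>{0..T}. s t)" for T by (simp add: s(1))
    show "(MIN t\<in>{0..T}. s t) \<le> K * sqrt (2 * C) * (1 + real T) powr (a - 1 / 2)" for T
    proof -
      obtain t where "t \<le> T" "s t \<le> \<epsilon>s T" using best by blast
      then have "(MIN t\<in>{0..T}. s t) \<le> \<epsilon>s T" by (intro order_trans[OF Min_le]) auto
      then show ?thesis by (simp add: \<epsilon>s_def)
    qed
  qed (use a in simp)
qed

text \<open>As \<open>0 powr 0 = 0\<close>, the two functions differ at \<open>T = 0\<close> and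
  agree only eventually.\<close>

lemma bigo_powr_zero: "O(\<lambda>T. real T powr 0) = O(\<lambda>T. 1 :: real)"
  by (intro landau_o.big.cong eventually_mono[OF eventually_gt_at_top[of 0]]) auto

section \<open>Rates for a polynomial penalty schedule\<close>

context penalized_lower
begin

text \<open>The vector in \<open>stationarity_measure_le_stch\<close> is \<open>c t\<close> times
  \<open>merit_grad\<close>, so the residual carries the growth of the penalty. The exponents
  \<open>a = 0\<close> and \<open>a = 1 / 4\<close> give the two schedules.\<close>

lemma momeha_rates:
  fixes f :: "'m::finite \<Rightarrow> 'a \<times> 'b \<Rightarrow> real" and w z :: "real ^ 'm"
  assumes F: "F = stch w z \<mu> f" and "0 < \<mu>" and f: "\<And>i p. f i differentiable (at p)"
    and \<omega>: "0 < \<omega>" "\<And>i. \<omega> \<le> w $ i"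
    and c: "\<And>t. c t = c0 * (1 + real t) powr a" and a: "0 \<le> a" "a \<le> 1 / 2"
    and sum: "\<And>T. (\<Sum>t<T. (norm (merit_grad (c t) (x (Suc t), y (Suc t))))\<^sup>2) \<le> C"
    and gap: "\<And>t. gap g \<gamma> (x t, y t) \<le> M * (1 + real t) powr - a"
  shows "\<exists>p. (\<forall>t. 0 \<le> p t) \<and>
           (\<lambda>T. gap g \<gamma> (x T, y T)) \<in> O(\<lambda>T. real T powr - a) \<and>
           (\<lambda>T. MIN t\<in>{0..T}. stationarity_measure f g \<gamma> (p t) (x (Suc t), y (Suc t)))
             \<in> O(\<lambda>T. real T powr (a - 1 / 2))" (is ?A)
    and "\<exists>\<epsilon>c \<epsilon>s. \<epsilon>c \<in> O(\<lambda>T. real T powr - a) \<and> \<epsilon>s \<in> O(\<lambda>T. real T powr (a - 1 / 2)) \<and>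
           (\<forall>T. \<exists>t\<le>T. pareto_stationary f g \<gamma> (\<epsilon>c T) (\<epsilon>s T) (x (Suc t), y (Suc t)))" (is ?B)
proof -
  let ?u = "\<lambda>t. (x (Suc t), y (Suc t))"
  let ?n = "\<lambda>t. norm (merit_grad (c t) (?u t))"
  have cpos: "0 < c t" for t using c0_pos by (simp add: c)
  have "\<exists>p\<ge>0. stationarity_measure f g \<gamma> p (?u t) \<le> c t * ?n t / \<omega>" for t
  proof -
    have "grad F (?u t) + c t *\<^sub>R (grad g (?u t) - grad (moreau_value g \<gamma>) (?u t))
        = c t *\<^sub>R merit_grad (c t) (?u t)"
      using cpos[of t] by (simp add: merit_grad_def grad_eqI[OF moreau_deriv] scaleR_add_right)
    moreover have "\<exists>p\<ge>0. stationarity_measure f g \<gamma> p (?u t)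
        \<le> norm (grad F (?u t) + c t *\<^sub>R (grad g (?u t) - grad (moreau_value g \<gamma>) (?u t))) / \<omega>"
      unfolding F by (rule stationarity_measure_le_stch[OF \<open>0 < \<mu>\<close> f \<omega> less_imp_le[OF cpos]])
    ultimately show ?thesis using cpos[of t] by simp
  qed
  then obtain p where p: "\<And>t. 0 \<le> p t"
    "\<And>t. stationarity_measure f g \<gamma> (p t) (?u t) \<le> c t * ?n t / \<omega>" by metis
  have s: "stationarity_measure f g \<gamma> (p t) (?u t) \<le> c0 / \<omega> * (1 + real t) powr a * ?n t" for t
    using p(2)[of t] by (simp add: c)
  define G where "G t = gap g \<gamma> (x t, y t)" for t
  define S where "S t = stationarity_measure f g \<gamma> (p t) (?u t)" for t
  have K: "0 \<le> c0 / \<omega>" using c0_pos \<omega> by simp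
  note rates = best_iterate_rates[of G M a S "c0 / \<omega>" ?n C, unfolded G_def S_def, OF gap_nonneg gap
      stationarity_measure_nonneg s norm_ge_zero sum a K]
  show ?A
    by (intro exI[of _ p] conjI allI p(1) rates(1,2))
  obtain \<epsilon>c \<epsilon>s where \<epsilon>: "\<epsilon>c \<in> O(\<lambda>T. real T powr - a)" "\<epsilon>s \<in> O(\<lambda>T. real T powr (a - 1 / 2))"
    and best: "\<forall>T. \<exists>t\<le>T. gap g \<gamma> (?u t) \<le> \<epsilon>c T \<and> stationarity_measure f g \<gamma> (p t) (?u t) \<le> \<epsilon>s T"
    using rates(3) by blast
  have "\<exists>t\<le>T. pareto_stationary f g \<gamma> (\<epsilon>c T) (\<epsilon>s T) (?u t)" for T
  proof -
    obtain t where "t \<le> T" "gap g \<gamma> (?u t) \<le> \<epsilon>c T" "stationarity_measure f g \<gamma> (p t) (?u t) \<le> \<epsilon>s T"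
      using best by blast
    then show ?thesis
      unfolding pareto_stationary_def by (intro exI[of _ t] conjI exI[of _ "p t"] p(1))
  qed
  with \<epsilon> show ?B by blast
qed

end

section \<open>Convergence rates for constant and growing penalties\<close>

theorem theorem1:
  fixes f :: "'m::finite \<Rightarrow> (real ^ 'dx::finite) \<times> (real ^ 'dy::finite) \<Rightarrow> real"
    and g :: "(real ^ 'dx) \<times> (real ^ 'dy) \<Rightarrow> real"
    and w z :: "real ^ 'm"
    and \<mu> Flow Lf Lg LF \<rho>x \<rho>y \<gamma> c0 a\<theta>_lo :: real
    and x0 :: "real ^ 'dx" and y0 :: "real ^ 'dy"
    and a\<theta> :: "nat \<Rightarrow> real"
  defines "F \<equiv> stch w z \<mu> f"
  assumes \<mu>: "0 < \<mu>" and w: "w \<in> pos_simplex"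
    and ideal: "\<And>i p. z $ i < f i p"
    and A1_f: "\<And>i. bdd_below (range (f i))"
    and A1_F: "\<And>p. Flow \<le> F p"
    and A2_f: "\<And>i. lipschitz_smooth Lf (f i)"
    and A2_g: "lipschitz_smooth Lg g"
    and A2_F: "lipschitz_smooth LF F"
    and A2_weak: "0 < \<rho>x" "0 < \<rho>y" "weakly_convex \<rho>x \<rho>y g"
    and A3: "\<And>p. 0 < gap g \<gamma> p \<Longrightarrow>
       gap g \<gamma> p \<le> 1 / c0 * penalized F Flow g \<gamma> c0 (x0, y0)
          + (Lg\<^sup>2 + 1 / \<gamma>\<^sup>2) * (norm (y0 - prox_argmin g \<gamma> (x0, y0)))\<^sup>2 \<Longrightarrow>
       grad g p - grad (moreau_value g \<gamma>) p \<noteq> 0"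
    and \<gamma>: "0 < \<gamma>" "\<gamma> < 1 / (2 * \<rho>y)"
    and c0: "0 < c0"
    and a\<theta>: "0 < a\<theta>_lo"
      "\<And>t. a\<theta>_lo \<le> a\<theta> t \<and> a\<theta> t < 2 * \<gamma> / (\<gamma> * (Lg - \<rho>y) + 2)"
  shows "\<exists>ax_up>0. \<exists>ay_up>0. \<forall>ax_lo>0. \<forall>ay_lo>0. \<forall>ax ay.
    (\<forall>t. ax t \<in> {ax_lo..ax_up}) \<and> (\<forall>t. ay t \<in> {ay_lo..ay_up}) \<longrightarrow>
      (\<forall>x y \<theta>. momeha F g \<gamma> x0 y0 a\<theta> ax ay (\<lambda>t. c0) x y \<theta> \<longrightarrow>
        (\<exists>p. (\<forall>t. 0 \<le> p t) \<and>
           (\<lambda>T. gap g \<gamma> (x T, y T)) \<in> O(\<lambda>T. 1) \<and>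
           (\<lambda>T. MIN t\<in>{0..T}. stationarity_measure f g \<gamma> (p t) (x (Suc t), y (Suc t)))
             \<in> O(\<lambda>T. real T powr (- 1 / 2))) \<and>
        (\<exists>\<epsilon>c \<epsilon>s. \<epsilon>c \<in> O(\<lambda>T. 1) \<and> \<epsilon>s \<in> O(\<lambda>T. real T powr (- 1 / 2)) \<and>
           (\<forall>T. \<exists>t\<le>T. pareto_stationary f g \<gamma> (\<epsilon>c T) (\<epsilon>s T) (x (Suc t), y (Suc t))))) \<and>
      (\<forall>c x y \<theta>. (\<forall>t. c t = c0 * (1 + real t) powr (1 / 4)) \<and>
        momeha F g \<gamma> x0 y0 a\<theta> ax ay c x y \<theta> \<and>
        bdd_above (range (\<lambda>t. penalized F Flow g \<gamma> (c t) (x t, y t))) \<longrightarrow>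
        (\<exists>p. (\<forall>t. 0 \<le> p t) \<and>
           (\<lambda>T. gap g \<gamma> (x T, y T)) \<in> O(\<lambda>T. real T powr (- 1 / 4)) \<and>
           (\<lambda>T. MIN t\<in>{0..T}. stationarity_measure f g \<gamma> (p t) (x (Suc t), y (Suc t)))
             \<in> O(\<lambda>T. real T powr (- 1 / 4))) \<and>
        (\<exists>\<epsilon>c \<epsilon>s. \<epsilon>c \<in> O(\<lambda>T. real T powr (- 1 / 4)) \<and>
           \<epsilon>s \<in> O(\<lambda>T. real T powr (- 1 / 4)) \<and>
           (\<forall>T. \<exists>t\<le>T. pareto_stationary f g \<gamma> (\<epsilon>c T) (\<epsilon>s T) (x (Suc t), y (Suc t)))))"
proof -
  have "\<gamma> * \<rho>y < 1"
    using \<gamma> A2_weak(2) mult_pos_pos[OF \<gamma>(1) A2_weak(2)] by (simp add: field_simps)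
  then interpret penalized_lower g Lg \<rho>x \<rho>y \<gamma> F LF Flow c0
    using A2_g A2_weak A2_F A1_F \<gamma> c0 by unfold_locales auto
  \<comment> \<open>Clearing denominators: \<open>\<gamma> * (Lg - \<rho>y) + 2\<close> is positive,
    since a positive step lies below the given quotient.\<close>
  have a\<theta>_up: "a\<theta> t * (Lg - \<rho>y + 2 / \<gamma>) \<le> 2" for t
  proof -
    have "0 < 2 * \<gamma> / (\<gamma> * (Lg - \<rho>y) + 2)" using a\<theta>(1) a\<theta>(2)[of t] by linarith
    then have "0 < \<gamma> * (Lg - \<rho>y) + 2" using \<gamma>(1) by (simp add: zero_less_divide_iff)
    then have "a\<theta> t * (\<gamma> * (Lg - \<rho>y) + 2) \<le> 2 * \<gamma>"
      using a\<theta>(2)[of t] by (simp add: pos_less_divide_eq less_imp_le)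
    moreover have "a\<theta> t * (\<gamma> * (Lg - \<rho>y) + 2) = a\<theta> t * (Lg - \<rho>y + 2 / \<gamma>) * \<gamma>"
      using \<gamma>(1) by (simp add: distrib_left distrib_right)
    ultimately show ?thesis using \<gamma>(1) by simp
  qed
  have a\<theta>_lo: "a\<theta>_lo \<le> a\<theta> t" for t using a\<theta>(2) by blast
  \<comment> \<open>The smallest entry of \<open>w\<close>, positive because there are finitely many
    entries.\<close>
  define \<omega> where "\<omega> = Min (range (($) w))"
  have \<omega>: "0 < \<omega>" "\<And>i. \<omega> \<le> w $ i"
    using w by (auto simp: \<omega>_def pos_simplex_def)
  have f: "f i differentiable (at p)" for i p
    using A2_f[of i] unfolding lipschitz_smooth_def by blast
  note rates = momeha_rates[OF meta_eq_to_obj_eq[OF F_def] \<mu> f \<omega>]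
  \<comment> \<open>This bound depends on the penalties only through \<open>c0\<close>, so a single
    \<open>A\<close> serves both blocks of variables and both schedules.\<close>
  obtain A where A: "admissible_step (a\<theta>_lo * modulus) A"
    using admissible_step_exists a\<theta>(1) modulus_pos by (meson mult_pos_pos)
  then have "0 < A" by (simp add: admissible_step_def)
  show ?thesis
  proof (intro exI[of _ A] conjI allI impI \<open>0 < A\<close>; (elim conjE)?)
    fix ax_lo ay_lo ax ay x y \<theta>
    assume lo: "0 < ax_lo" "0 < ay_lo" and ax: "\<forall>t. ax t \<in> {ax_lo..A}" and ay: "\<forall>t. ay t \<in> {ay_lo..A}"
      and alg: "momeha F g \<gamma> x0 y0 a\<theta> ax ay (\<lambda>t. c0) x y \<theta>"
    obtain C V where "\<And>T. (\<Sum>t<T. (norm (merit_grad c0 (x (Suc t), y (Suc t))))\<^sup>2) \<le> C"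
      and "\<And>t. gap g \<gamma> (x t, y t) \<le> V"
      using momeha_bounds[OF alg order_refl order_refl a\<theta>(1) a\<theta>_lo a\<theta>_up A lo(1) spec[OF ax] lo(2) spec[OF ay]]
      by blast
    \<comment> \<open>The constant schedule is the case \<open>a = 0\<close>.\<close>
    moreover have "(1 + real t) powr 0 = 1" for t by simp
    moreover note rates[where c = "\<lambda>_. c0" and a = 0 and M = V and C = C and x = x and y = y]
    ultimately show "\<exists>p. (\<forall>t. 0 \<le> p t) \<and>
           (\<lambda>T. gap g \<gamma> (x T, y T)) \<in> O(\<lambda>T. 1) \<and>
           (\<lambda>T. MIN t\<in>{0..T}. stationarity_measure f g \<gamma> (p t) (x (Suc t), y (Suc t)))
             \<in> O(\<lambda>T. real T powr (- 1 / 2))"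
      "\<exists>\<epsilon>c \<epsilon>s. \<epsilon>c \<in> O(\<lambda>T. 1) \<and> \<epsilon>s \<in> O(\<lambda>T. real T powr (- 1 / 2)) \<and>
           (\<forall>T. \<exists>t\<le>T. pareto_stationary f g \<gamma> (\<epsilon>c T) (\<epsilon>s T) (x (Suc t), y (Suc t)))"
      by (simp_all add: bigo_powr_zero del: powr_zero_eq_one)
  next
    fix ax_lo ay_lo ax ay c x y \<theta>
    assume lo: "0 < ax_lo" "0 < ay_lo" and ax: "\<forall>t. ax t \<in> {ax_lo..A}" and ay: "\<forall>t. ay t \<in> {ay_lo..A}"
      and c: "\<forall>t. c t = c0 * (1 + real t) powr (1 / 4)"
      and alg: "momeha F g \<gamma> x0 y0 a\<theta> ax ay c x y \<theta>"
      and bdd: "bdd_above (range (\<lambda>t. penalized F Flow g \<gamma> (c t) (x t, y t)))"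
    have c_lo: "c0 \<le> c t" for t
      using mult_left_mono[OF ge_one_powr_ge_zero[of "1 + real t" "1 / 4"], of c0] c0 by (simp add: c)
    have c_mono: "c t \<le> c (Suc t)" for t
      using c0 by (simp add: c powr_mono2)
    obtain C where C: "\<And>T. (\<Sum>t<T. (norm (merit_grad (c t) (x (Suc t), y (Suc t))))\<^sup>2) \<le> C"
      using momeha_bounds[OF alg c_lo c_mono a\<theta>(1) a\<theta>_lo a\<theta>_up A lo(1) spec[OF ax] lo(2) spec[OF ay]]
      by blast
    obtain M where M: "\<And>t. penalized F Flow g \<gamma> (c t) (x t, y t) \<le> M"
      using bdd by (auto simp: bdd_above_def)
    \<comment> \<open>The boundedness assumption enters here: \<open>F - Flow\<close> is
      nonnegative, so \<open>c t\<close> times the gap is at most \<open>M\<close>.\<close>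
    have "gap g \<gamma> (x t, y t) \<le> M / c0 * (1 + real t) powr - (1 / 4)" for t
    proof -
      have "c t * gap g \<gamma> (x t, y t) \<le> M"
        using M[of t] A1_F[of "(x t, y t)"] by (simp add: penalized_def)
      moreover have "0 < c t" using c_lo[of t] c0 by linarith
      ultimately have "gap g \<gamma> (x t, y t) \<le> M / c t"
        by (simp add: pos_le_divide_eq mult.commute)
      then show ?thesis by (simp add: c powr_minus_divide)
    qed
    with rates[where c = c and a = "1 / 4" and M = "M / c0" and C = C and x = x and y = y] c C
    show "\<exists>p. (\<forall>t. 0 \<le> p t) \<and>
           (\<lambda>T. gap g \<gamma> (x T, y T)) \<in> O(\<lambda>T. real T powr (- 1 / 4)) \<and>
           (\<lambda>T. MIN t\<in>{0..T}. stationarity_measure f g \<gamma> (p t) (x (Suc t), y (Suc t)))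
             \<in> O(\<lambda>T. real T powr (- 1 / 4))"
      "\<exists>\<epsilon>c \<epsilon>s. \<epsilon>c \<in> O(\<lambda>T. real T powr (- 1 / 4)) \<and>
           \<epsilon>s \<in> O(\<lambda>T. real T powr (- 1 / 4)) \<and>
           (\<forall>T. \<exists>t\<le>T. pareto_stationary f g \<gamma> (\<epsilon>c T) (\<epsilon>s T) (x (Suc t), y (Suc t)))"
      by simp_all
  qed
qed

end
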